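(* Let $d\in\mathbb{N}$ and $\alpha\in(0,2]$, and let $X$ be a centered $d$-dimensional spherically symmetric $\alpha$-stable random variable (with standard scale normalization). Then the characteristic function and the density of $X$ are, respectively, $$f_{\alpha,d}(\xi)=\exp(-|\xi|^\alpha),\quad\xi\in\mathbb{R}^d,$$ and $$\rho_{\alpha,d}(x)=\pi^{-d/2}|x|^{-d}\,H^{1,1}_{1,2}\!\left((|x|/2)^\alpha\,\middle|\,\begin{array}{l}(1,1)\\(d/2,\alpha/2),(1,\alpha/2)\end{array}\right),\quad x\in\mathbb{R}^d\setminus\{0\}.$$
   Context: Standard scale normalization means that the scale parameter is such that $\mathbb{E}\,e^{i\xi\cdot X}=\exp(-|\xi|^\alpha)$; thus the content is that the probability density on $\mathbb{R}^d$ with characteristic function $\exp(-|\xi|^\alpha)$ is $\rho_{\alpha,d}$. Fox H-function: for integers $0\le m\le q$, $0\le n\le p$, complex $a_i,b_j$ and positive $\alpha_i,\beta_j$, $$H^{m,n}_{p,q}\!\left(z\,\middle|\,\begin{array}{l}(a_1,\alpha_1),\dots,(a_p,\alpha_p)\\(b_1,\beta_1),\dots,(b_q,\beta_q)\end{array}\right)=\frac1{2\pi i}\int_L\frac{\prod_{j=1}^m\Gamma(b_j+\beta_js)\prod_{i=1}^n\Gamma(1-a_i-\alpha_is)}{\prod_{i=n+1}^p\Gamma(a_i+\alpha_is)\prod_{j=m+1}^q\Gamma(1-b_j-\beta_js)}\,z^{-s}\,ds,$$ with empty products equal to $1$, where $L$ separates the poles of $\Gamma(b_j+\beta_js)$,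 $1\le j\le m$ (to its left) from the poles of $\Gamma(1-a_i-\alpha_is)$, $1\le i\le n$ (to its right). For the H-function above, $a^*:=\sum_{i\le n}\alpha_i-\sum_{i>n}\alpha_i+\sum_{j\le m}\beta_j-\sum_{j>m}\beta_j=1>0$, and $L$ may be taken to be an upward vertical line $\Re s=\gamma$ with $-d/\alpha<\gamma<0$. *)

theory Defs
  imports "HOL-Probability.Probability"
begin

section \<open>The Fox H-function\<close>

text \<open>
  The parameters \<open>(a\<^sub>1, \<alpha>\<^sub>1), \<dots>, (a\<^sub>p, \<alpha>\<^sub>p)\<close> and \<open>(b\<^sub>1, \<beta>\<^sub>1), \<dots>, (b\<^sub>q, \<beta>\<^sub>q)\<close>
  are lists \<open>A\<close> and \<open>B\<close>, indexed from \<open>0\<close>; so \<open>p = length A\<close> and \<open>q = length B\<close>, and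
  \<open>m \<le> q\<close>, \<open>n \<le> p\<close>, \<open>\<alpha>\<^sub>i, \<beta>\<^sub>j > 0\<close> are understood.  The power \<open>z\<^sup>-\<^sup>s\<close> is the principal one.
  Since \<open>Gamma\<close> is \<open>0\<close> at its poles and \<open>x / 0 = 0\<close>, a pole of a Gamma factor in the
  denominator makes the quotient vanish, in accordance with \<open>1 / \<Gamma>\<close> being entire.
\<close>

definition foxH_integrand ::
  "nat \<Rightarrow> nat \<Rightarrow> (complex \<times> real) list \<Rightarrow> (complex \<times> real) list \<Rightarrow> complex \<Rightarrow> complex \<Rightarrow> complex"
  where "foxH_integrand m n A B z s =
    ((\<Prod>j<m. Gamma (fst (B ! j) + of_real (snd (B ! j)) * s)) *
     (\<Prod>i<n. Gamma (1 - fst (A ! i) - of_real (snd (A ! i)) * s))) /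
    ((\<Prod>i=n..<length A. Gamma (fst (A ! i) + of_real (snd (A ! i)) * s)) *
     (\<Prod>j=m..<length B. Gamma (1 - fst (B ! j) - of_real (snd (B ! j)) * s))) *
    z powr (-s)"

text \<open>
  The vertical line \<open>Re s = \<gamma>\<close> has the poles of the \<open>\<Gamma>(b\<^sub>j + \<beta>\<^sub>j s)\<close>, \<open>j \<le> m\<close>, to its left
  and those of the \<open>\<Gamma>(1 - a\<^sub>i - \<alpha>\<^sub>i s)\<close>, \<open>i \<le> n\<close>, to its right.
\<close>

definition foxH_separates ::
  "nat \<Rightarrow> nat \<Rightarrow> (complex \<times> real) list \<Rightarrow> (complex \<times> real) list \<Rightarrow> real \<Rightarrow> bool"
  where "foxH_separates m n A B \<gamma> \<longleftrightarrow>
    (\<forall>j<m. \<forall>s. fst (B ! j) + of_real (snd (B ! j)) * s \<in> \<int>\<^sub>\<le>\<^sub>0 \<longrightarrow> Re s < \<gamma>) \<and>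
    (\<forall>i<n. \<forall>s. 1 - fst (A ! i) - of_real (snd (A ! i)) * s \<in> \<int>\<^sub>\<le>\<^sub>0 \<longrightarrow> \<gamma> < Re s)"

text \<open>
  The contour \<open>L\<close> is an upward vertical line \<open>s = \<gamma> + \<i> t\<close>, \<open>ds = \<i> dt\<close>.  This covers parameters
  for which some vertical line separates the poles; contours that have to be bent are not
  considered.  The value is the number given by all separating lines along which the
  integral converges; it is unspecified if there is no such line.
\<close>

definition foxH ::
  "nat \<Rightarrow> nat \<Rightarrow> (complex \<times> real) list \<Rightarrow> (complex \<times> real) list \<Rightarrow> complex \<Rightarrow> complex"
  where "foxH m n A B z = (THE w. \<exists>\<gamma>. foxH_separates m n A B \<gamma> \<and>
    ((\<lambda>t::real. foxH_integrand m n A B z (Complex \<gamma> t) * \<i>) has_integral (2 * of_real pi * \<i> * w)) UNIV)"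


section \<open>Spherically symmetric stable laws\<close>

definition char_fun :: "'a::euclidean_space measure \<Rightarrow> 'a \<Rightarrow> complex"
  where "char_fun N \<xi> = (CLINT x|N. iexp (\<xi> \<bullet> x))"

text \<open>
  Symmetry is with respect to the origin, so that it includes centredness (location
  parameter \<open>0\<close>).
\<close>

definition spherically_symmetric :: "'a::euclidean_space measure \<Rightarrow> bool"
  where "spherically_symmetric N \<longleftrightarrow>
    (\<forall>U. orthogonal_transformation U \<longrightarrow> distr N borel U = N)"

text \<open>
  Stability of index \<open>\<alpha>\<close>: if \<open>X\<^sub>1, X\<^sub>2\<close> are independent copies of \<open>X\<close>, then \<open>a X\<^sub>1 + b X\<^sub>2\<close> has
  the law of \<open>(a\<^sup>\<alpha> + b\<^sup>\<alpha>)\<^sup>1\<^sup>/\<^sup>\<alpha> X + c\<close>.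
\<close>

definition stable_law :: "real \<Rightarrow> 'a::euclidean_space measure \<Rightarrow> bool"
  where "stable_law \<alpha> N \<longleftrightarrow> (\<forall>a>0. \<forall>b>0. \<exists>c.
    distr (N \<Otimes>\<^sub>M N) borel (\<lambda>(x, y). a *\<^sub>R x + b *\<^sub>R y) =
    distr N borel (\<lambda>x. (a powr \<alpha> + b powr \<alpha>) powr (1 / \<alpha>) *\<^sub>R x + c))"

text \<open>
  A centred spherically symmetric \<open>\<alpha>\<close>-stable law has characteristic function
  \<open>exp (- (\<sigma> |\<xi>|)\<^sup>\<alpha>)\<close> for some scale parameter \<open>\<sigma> \<ge> 0\<close>.  The normalization \<open>\<sigma> = 1\<close> is imposed
  through the value on the unit sphere only, so that the form of the characteristic function
  is not presupposed.  It also rules out the degenerate law at the origin.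
\<close>

definition unit_scale :: "'a::euclidean_space measure \<Rightarrow> bool"
  where "unit_scale N \<longleftrightarrow> (\<forall>u. norm u = 1 \<longrightarrow> char_fun N u = of_real (exp (-1)))"

text \<open>
  The value at \<open>x = 0\<close> is meaningless.
\<close>

definition stable_density :: "real \<Rightarrow> real ^ 'd \<Rightarrow> complex"
  where "stable_density \<alpha> x =
    of_real (pi powr (- real CARD('d) / 2) * norm x powr (- real CARD('d))) *
    foxH 1 1 [(1, 1)] [(of_real (real CARD('d) / 2), \<alpha> / 2), (1, \<alpha> / 2)]
      (of_real ((norm x / 2) powr \<alpha>))"

end

theory Submission
  imports Defs
begin

text \<open>
  Stability and symmetry say that \<open>\<bar>\<phi>\<bar>\<close>, restricted to a ray and reparametrized by \<open>t = r\<^sup>\<alpha>\<close>, is a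
  continuous solution of \<open>H (s + t) = H s * H t\<close>, whence \<open>\<phi> \<xi> = exp (- \<bar>\<xi>\<bar>\<^sup>\<alpha>)\<close>.  This is integrable, so
  Fourier inversion gives a continuous density \<open>\<rho>\<close>, which is radial.

  Averaging \<open>exp (- u \<bar>X\<bar>\<^sup>2)\<close> in two ways and taking Mellin transforms in \<open>u\<close> gives
  \<open>E \<bar>X\<bar>\<^sup>\<alpha>\<^sup>s = 2 / \<alpha> * 2\<^sup>\<alpha>\<^sup>s * \<Gamma>(-s) * \<Gamma>(d/2 + \<alpha>s/2) / (\<Gamma>(-\<alpha>s/2) * \<Gamma>(d/2))\<close> for \<open>-d/\<alpha> < Re s < 0\<close>.
  Up to a factor this is the Gamma quotient in the H-function, and its Mellin inversion along any line in
  that strip, which is Fourier inversion in the variable \<open>- ln \<bar>x\<bar>\<close>, returns \<open>\<rho>\<close>.  Hence all separating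
  lines give the same value and no contour has to be moved.  Stirling's formula is avoided as well:
  the product formula shows \<open>\<bar>\<Gamma>(w/a) / \<Gamma>(w)\<bar> \<le> \<Gamma>(Re w/a) / \<Gamma>(Re w)\<close> for \<open>0 < a \<le> 1\<close>, so the quotient
  decays along vertical lines at least like one Gamma function.
\<close>

section \<open>Fourier inversion\<close>

definition std_gauss :: "'a::euclidean_space \<Rightarrow> real" where
  "std_gauss x = (2 * pi) powr (- real DIM('a) / 2) * exp (- (norm x)\<^sup>2 / 2)"

lemma std_gauss_pos: "0 < std_gauss x"
  by (simp add: std_gauss_def)

lemma std_gauss_le: "std_gauss (x::'a::euclidean_space) \<le> (2 * pi) powr (- real DIM('a) / 2)"
  by (simp add: std_gauss_def mult_le_cancel_left1)

lemma continuous_std_gauss: "continuous_on UNIV std_gauss"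
  unfolding std_gauss_def by (intro continuous_intros) auto

lemma borel_measurable_std_gauss [measurable]: "std_gauss \<in> borel_measurable borel"
  by (intro borel_measurable_continuous_onI continuous_std_gauss)

lemma std_gauss_prod:
  "std_gauss (x::'a::euclidean_space) = (\<Prod>b\<in>Basis. std_normal_density (x \<bullet> b))"
proof -
  have "(\<Prod>b\<in>Basis. std_normal_density (x \<bullet> b)) =
      (1 / sqrt (2 * pi)) ^ DIM('a) * exp (\<Sum>b\<in>Basis. - (x \<bullet> b)\<^sup>2 / 2)"
    by (simp add: normal_density_def prod.distrib prod_dividef exp_sum power_divide)
  also have "(\<Sum>b\<in>Basis. - (x \<bullet> b)\<^sup>2 / 2) = - (norm x)\<^sup>2 / 2"
    by (simp add: norm_eq_sqrt_inner euclidean_inner[of x x] sum_nonneg power2_eq_square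
        sum_divide_distrib sum_negf)
  also have "(1 / sqrt (2 * pi)) ^ DIM('a) = (2 * pi) powr (- real DIM('a) / 2)"
  proof -
    have "(1 / sqrt (2 * pi)) = (2 * pi) powr (-1/2)"
      by (simp add: powr_minus powr_half_sqrt field_simps)
    then have "(1 / sqrt (2 * pi)) ^ DIM('a) = ((2 * pi) powr (-1/2)) powr real DIM('a)"
      by (simp only: powr_realpow powr_gt_zero) (simp add: powr_realpow)
    then show ?thesis by (simp add: powr_powr)
  qed
  finally show ?thesis by (simp add: std_gauss_def)
qed

text \<open>\<open>lborel\<close> is the image of the product of one-dimensional Lebesgue measures
  under the coordinate map, so Fubini for finite products applies.\<close>

lemma lborel_prod_Basis:
  fixes f :: "'a::euclidean_space \<Rightarrow> real \<Rightarrow> complex"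
  assumes f: "\<And>b. b \<in> Basis \<Longrightarrow> integrable lborel (f b)"
  shows "integrable (lborel :: 'a measure) (\<lambda>x. \<Prod>b\<in>Basis. f b (x \<bullet> b))"
    and "(\<integral>x. (\<Prod>b\<in>Basis. f b (x \<bullet> b)) \<partial>(lborel :: 'a measure)) = (\<Prod>b\<in>Basis. integral\<^sup>L lborel (f b))"
proof -
  interpret product_sigma_finite "\<lambda>_::'a. lborel :: real measure" ..
  have [measurable]: "\<And>b. b \<in> Basis \<Longrightarrow> f b \<in> borel_measurable borel"
    using f by (auto dest: borel_measurable_integrable)
  have *: "(\<Prod>b\<in>Basis. f b ((\<Sum>c\<in>Basis. g c *\<^sub>R c) \<bullet> b)) = (\<Prod>b\<in>Basis. f b (g b))" for g
    by (intro prod.cong refl) simp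
  show "integrable (lborel :: 'a measure) (\<lambda>x. \<Prod>b\<in>Basis. f b (x \<bullet> b))"
    by (subst lborel_eq, subst integrable_distr_eq) (simp_all add: * product_integrable_prod f)
  show "(\<integral>x. (\<Prod>b\<in>Basis. f b (x \<bullet> b)) \<partial>(lborel :: 'a measure)) = (\<Prod>b\<in>Basis. integral\<^sup>L lborel (f b))"
    by (subst lborel_eq, subst integral_distr) (simp_all add: * product_integral_prod f)
qed

text \<open>The integrand factors over the coordinates, and each factor integrates to the
  characteristic function of the standard normal distribution on the line.\<close>

lemma std_gauss_fourier:
  fixes \<xi> :: "'a::euclidean_space"
  shows "integrable lborel (\<lambda>x. iexp (\<xi> \<bullet> x) * std_gauss x)"
    and "(CLINT x|lborel. iexp (\<xi> \<bullet> x) * std_gauss x) = exp (- (norm \<xi>)\<^sup>2 / 2)"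
proof -
  define f where "f b t = iexp ((\<xi> \<bullet> b) * t) * complex_of_real (std_normal_density t)" for b t
  have eq: "iexp (\<xi> \<bullet> x) * complex_of_real (std_gauss x) = (\<Prod>b\<in>Basis. f b (x \<bullet> b))" for x
    unfolding f_def prod.distrib std_gauss_prod euclidean_inner[of \<xi> x]
    by (simp add: exp_sum[symmetric] sum_distrib_left)
  have int: "integrable lborel (f b)" for b
  proof -
    have [measurable]: "f b \<in> borel_measurable borel"
      unfolding f_def by measurable
    have "integrable lborel (\<lambda>t. norm (f b t))"
      by (simp add: f_def norm_mult abs_of_nonneg integrable_normal_density)
    then show ?thesis
      by (subst (asm) integrable_norm_iff) auto
  qed
  have val: "integral\<^sup>L lborel (f b) = exp (- (\<xi> \<bullet> b)\<^sup>2 / 2)" for b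
  proof -
    have "integral\<^sup>L lborel (f b) = char std_normal_distribution (\<xi> \<bullet> b)"
      unfolding char_def f_def
      by (subst integral_density) (auto simp: scaleR_conv_of_real mult.commute)
    then show ?thesis by (simp add: char_std_normal_distribution)
  qed
  show "integrable lborel (\<lambda>x. iexp (\<xi> \<bullet> x) * std_gauss x)"
    unfolding eq by (rule lborel_prod_Basis) (rule int)
  have "(CLINT x|lborel. iexp (\<xi> \<bullet> x) * std_gauss x) = (\<Prod>b\<in>Basis. integral\<^sup>L lborel (f b))"
    unfolding eq by (rule lborel_prod_Basis) (rule int)
  also have "\<dots> = exp (\<Sum>b\<in>Basis. - (\<xi> \<bullet> b)\<^sup>2 / 2)"
    by (simp add: val exp_sum)
  also have "(\<Sum>b\<in>Basis. - (\<xi> \<bullet> b)\<^sup>2 / 2) = - (norm \<xi>)\<^sup>2 / 2"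
    by (simp add: norm_eq_sqrt_inner euclidean_inner[of \<xi> \<xi>] sum_nonneg power2_eq_square
        sum_divide_distrib sum_negf)
  finally show "(CLINT x|lborel. iexp (\<xi> \<bullet> x) * std_gauss x) = exp (- (norm \<xi>)\<^sup>2 / 2)" .
qed

lemma integrable_std_gauss: "integrable lborel std_gauss"
  using std_gauss_fourier(1)[of 0] by (simp add: complex_of_real_integrable_eq)

lemma integral_std_gauss: "integral\<^sup>L lborel (std_gauss :: 'a::euclidean_space \<Rightarrow> real) = 1"
  using std_gauss_fourier(2)[of "0::'a"] by simp

lemma lborel_integral_affine:
  fixes f :: "'a::euclidean_space \<Rightarrow> 'b::{banach, second_countable_topology}" and c :: real
  assumes c: "c \<noteq> 0" and [measurable]: "f \<in> borel_measurable borel"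
  shows "integral\<^sup>L lborel f = \<bar>c\<bar> ^ DIM('a) *\<^sub>R (\<integral>x. f (t + c *\<^sub>R x) \<partial>lborel)"
    and "integrable lborel (\<lambda>x. f (t + c *\<^sub>R x)) \<longleftrightarrow> integrable lborel f"
proof -
  show "integral\<^sup>L lborel f = \<bar>c\<bar> ^ DIM('a) *\<^sub>R (\<integral>x. f (t + c *\<^sub>R x) \<partial>lborel)"
    using c by (subst lborel_affine[OF c, of t])
      (simp add: integral_density integral_distr)
  show "integrable lborel (\<lambda>x. f (t + c *\<^sub>R x)) \<longleftrightarrow> integrable lborel f"
  proof -
    have "integrable lborel f \<longleftrightarrow> integrable lborel (\<lambda>x. \<bar>c\<bar> ^ DIM('a) *\<^sub>R f (t + c *\<^sub>R x))"
      using c by (subst lborel_affine[OF c, of t]) (simp add: integrable_density integrable_distr_eq)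
    moreover have "integrable lborel (\<lambda>x. inverse (\<bar>c\<bar> ^ DIM('a)) *\<^sub>R \<bar>c\<bar> ^ DIM('a) *\<^sub>R f (t + c *\<^sub>R x))"
      if "integrable lborel (\<lambda>x. \<bar>c\<bar> ^ DIM('a) *\<^sub>R f (t + c *\<^sub>R x))"
      using that by (rule integrable_scaleR_right)
    ultimately show ?thesis using c by auto
  qed
qed

section \<open>Inversion by Gaussian smoothing\<close>

text \<open>The candidate density. It is kept complex-valued; that it is real and nonnegative is
  learned only from its being a limit of smoothed densities.\<close>

definition inv_fourier :: "'a::euclidean_space measure \<Rightarrow> 'a \<Rightarrow> complex" where
  "inv_fourier N x = (2 * pi) powr (- real DIM('a)) * (CLINT \<xi>|lborel. iexp (- (\<xi> \<bullet> x)) * char_fun N \<xi>)"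

text \<open>For a probability law N this is the density of X + Z / K, where Z is a standard Gaussian
  vector independent of X.\<close>

definition gauss_smooth :: "'a::euclidean_space measure \<Rightarrow> real \<Rightarrow> 'a \<Rightarrow> real" where
  "gauss_smooth N K x = K ^ DIM('a) * (\<integral>y. std_gauss (K *\<^sub>R (y - x)) \<partial>N)"

text \<open>Finite rather than probability measures, since inversion is needed twice: for the stable
  law on the Euclidean space and, in the Mellin inversion, for an unnormalized measure on the
  line.\<close>

locale euclidean_finite_measure = finite_measure N for N :: "'a::euclidean_space measure" +
  assumes sets_N [measurable_cong, simp]: "sets N = sets borel"
begin

lemma space_N [simp]: "space N = UNIV"
  using sets_eq_imp_space_eq[OF sets_N] by simp

lemma borel_measurable_char_fun [measurable]: "char_fun N \<in> borel_measurable borel"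
  unfolding char_fun_def by measurable

lemma gauss_smooth_nonneg: "0 \<le> K \<Longrightarrow> 0 \<le> gauss_smooth N K x"
  unfolding gauss_smooth_def by (intro mult_nonneg_nonneg integral_nonneg) (auto simp: std_gauss_pos less_imp_le)

lemma borel_measurable_gauss_smooth [measurable]: "gauss_smooth N K \<in> borel_measurable borel"
  unfolding gauss_smooth_def by measurable

text \<open>The Gaussian is, up to a constant, its own Fourier transform. Writing it so inside the
  N-integral and exchanging the integrals produces the characteristic function; then \<xi> = K
  \<eta> is substituted. Fubini applies because the modulus of \<open>h y \<eta>\<close> is
  \<open>std_gauss \<eta>\<close> and N is finite.\<close>

lemma gauss_smooth_fourier:
  assumes K: "K > 0"
  shows "gauss_smooth N K x = (2 * pi) powr (- real DIM('a) / 2) *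
    (CLINT \<xi>|lborel. iexp (- (\<xi> \<bullet> x)) * char_fun N \<xi> * std_gauss ((1 / K) *\<^sub>R \<xi>))"
proof -
  interpret pair_sigma_finite N "lborel :: 'a measure" ..
  let ?c = "complex_of_real ((2 * pi) powr (- real DIM('a) / 2))"
  define h where "h y \<eta> = iexp ((K *\<^sub>R (y - x)) \<bullet> \<eta>) * complex_of_real (std_gauss \<eta>)" for y \<eta> :: 'a
  have [measurable]: "case_prod h \<in> borel_measurable (N \<Otimes>\<^sub>M lborel)"
    unfolding h_def by measurable
  have int: "integrable (N \<Otimes>\<^sub>M lborel) (case_prod h)"
  proof (rule Fubini_integrable)
    have "(\<integral>\<eta>. norm (h y \<eta>) \<partial>lborel) = 1" for y
      by (simp add: h_def norm_mult std_gauss_pos less_imp_le integral_std_gauss)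
    then show "integrable N (\<lambda>y. \<integral>\<eta>. norm (case (y, \<eta>) of (a, b) \<Rightarrow> h a b) \<partial>lborel)" by simp
    show "AE y in N. integrable lborel (\<lambda>\<eta>. case (y, \<eta>) of (a, b) \<Rightarrow> h a b)"
      using std_gauss_fourier(1)[of "K *\<^sub>R (y - x)" for y] by (auto simp: h_def)
  qed measurable
  have g: "complex_of_real (std_gauss (K *\<^sub>R (y - x))) = ?c * (\<integral>\<eta>. h y \<eta> \<partial>lborel)" for y
    unfolding h_def std_gauss_fourier(2) by (simp add: std_gauss_def)
  have "complex_of_real (\<integral>y. std_gauss (K *\<^sub>R (y - x)) \<partial>N) = ?c * (\<integral>y. (\<integral>\<eta>. h y \<eta> \<partial>lborel) \<partial>N)"
    by (simp add: integral_complex_of_real[symmetric] g del: integral_complex_of_real)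
  also have "(\<integral>y. (\<integral>\<eta>. h y \<eta> \<partial>lborel) \<partial>N) = (\<integral>\<eta>. (\<integral>y. h y \<eta> \<partial>N) \<partial>lborel)"
    using Fubini_integral[OF int] by simp
  also have "\<dots> = (\<integral>\<eta>. iexp (- (K *\<^sub>R \<eta>) \<bullet> x) * char_fun N (K *\<^sub>R \<eta>) * std_gauss \<eta> \<partial>lborel)"
  proof (rule Bochner_Integration.integral_cong[OF refl])
    fix \<eta> :: 'a
    have "h y \<eta> = (iexp (- (K *\<^sub>R \<eta>) \<bullet> x) * std_gauss \<eta>) * iexp ((K *\<^sub>R \<eta>) \<bullet> y)" for y
      by (simp add: h_def exp_add[symmetric] algebra_simps inner_commute)
    then show "(\<integral>y. h y \<eta> \<partial>N) = iexp (- (K *\<^sub>R \<eta>) \<bullet> x) * char_fun N (K *\<^sub>R \<eta>) * std_gauss \<eta>"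
      by (simp add: char_fun_def)
  qed
  also have "\<dots> = (1 / K) ^ DIM('a) *
      (\<integral>\<xi>. iexp (- (\<xi> \<bullet> x)) * char_fun N \<xi> * std_gauss ((1 / K) *\<^sub>R \<xi>) \<partial>lborel)"
    using K by (subst lborel_integral_affine(1)[where t = 0 and c = "1 / K"])
      (auto simp: scaleR_conv_of_real)
  finally show ?thesis
    using K by (simp add: gauss_smooth_def power_one_over field_simps)
qed

context
  assumes int_char: "integrable lborel (char_fun N)"
begin

text \<open>The bound is uniform in K and x, so that it can dominate in the limit K to infinity. One
  factor (2 pi)^(-d/2) comes from the Fourier representation, the other from the maximum of the
  Gaussian.\<close>

lemma gauss_smooth_le:
  assumes "K > 0"
  shows "gauss_smooth N K x \<le> (2 * pi) powr (- real DIM('a)) * (\<integral>\<xi>. norm (char_fun N \<xi>) \<partial>lborel)"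
proof -
  define c where "c = (2 * pi) powr (- real DIM('a) / 2)"
  have le: "std_gauss z \<le> c" for z :: 'a unfolding c_def by (rule std_gauss_le)
  have c: "c \<ge> 0" by (simp add: c_def)
  have [measurable]: "char_fun N \<in> borel_measurable lborel" by simp
  let ?f = "\<lambda>\<xi>. iexp (- (\<xi> \<bullet> x)) * char_fun N \<xi> * complex_of_real (std_gauss ((1 / K) *\<^sub>R \<xi>))"
  have "gauss_smooth N K x = norm (complex_of_real (gauss_smooth N K x))"
    using gauss_smooth_nonneg assms by simp
  also have "\<dots> = c * norm (integral\<^sup>L lborel ?f)"
    unfolding gauss_smooth_fourier[OF assms] by (simp add: norm_mult c_def)
  also have "norm (integral\<^sup>L lborel ?f) \<le> (\<integral>\<xi>. c * norm (char_fun N \<xi>) \<partial>lborel)"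
  proof (rule Bochner_Integration.integral_norm_bound_integral)
    show bound: "norm (?f \<xi>) \<le> c * norm (char_fun N \<xi>)" for \<xi>
      using mult_right_mono[OF le[of "(1 / K) *\<^sub>R \<xi>"], of "norm (char_fun N \<xi>)"]
      by (simp add: norm_mult std_gauss_pos less_imp_le mult.commute)
    show int: "integrable lborel (\<lambda>\<xi>. c * norm (char_fun N \<xi>))"
      using int_char by simp
    show "integrable lborel ?f"
      using int _ AE_I2
    proof (rule Bochner_Integration.integrable_bound)
      show "norm (?f \<xi>) \<le> norm (c * norm (char_fun N \<xi>))" for \<xi>
        using bound[of \<xi>] by (rule order_trans) simp
    qed measurable
  qed
  also have "c * \<dots> = (2 * pi) powr (- real DIM('a)) * (\<integral>\<xi>. norm (char_fun N \<xi>) \<partial>lborel)"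
    by (simp add: c_def powr_add[symmetric] mult.assoc[symmetric])
  finally show ?thesis using c by (simp add: mult_left_mono)
qed

text \<open>As K grows, the Gaussian factor in \<open>gauss_smooth_fourier\<close> tends to its
  value at 0, which supplies the second factor (2 pi)^(-d/2); integrability of the characteristic
  function gives domination.\<close>

lemma tendsto_gauss_smooth_complex:
  "(\<lambda>n. complex_of_real (gauss_smooth N (real (Suc n)) x)) \<longlonglongrightarrow> inv_fourier N x"
proof -
  let ?c = "(2 * pi) powr (- real DIM('a) / 2)"
  have "(\<lambda>n. \<integral>\<xi>. iexp (- (\<xi> \<bullet> x)) * char_fun N \<xi> * complex_of_real (std_gauss ((1 / real (Suc n)) *\<^sub>R \<xi>)) \<partial>lborel)
     \<longlonglongrightarrow> (\<integral>\<xi>. iexp (- (\<xi> \<bullet> x)) * char_fun N \<xi> * complex_of_real (std_gauss (0::'a)) \<partial>lborel)"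
  proof (rule integral_dominated_convergence[where w = "\<lambda>\<xi>. ?c * norm (char_fun N \<xi>)"])
    show "AE \<xi> in lborel. norm (iexp (- (\<xi> \<bullet> x)) * char_fun N \<xi> *
        complex_of_real (std_gauss ((1 / real (Suc n)) *\<^sub>R \<xi>))) \<le> ?c * norm (char_fun N \<xi>)" for n
    proof (rule AE_I2)
      fix \<xi>
      show "norm (iexp (- (\<xi> \<bullet> x)) * char_fun N \<xi> *
        complex_of_real (std_gauss ((1 / real (Suc n)) *\<^sub>R \<xi>))) \<le> ?c * norm (char_fun N \<xi>)"
        using mult_right_mono[OF std_gauss_le[of "(1 / real (Suc n)) *\<^sub>R \<xi>"], of "norm (char_fun N \<xi>)"]
        by (simp add: norm_mult std_gauss_pos less_imp_le mult.commute)
    qed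
    show "integrable lborel (\<lambda>\<xi>. ?c * norm (char_fun N \<xi>))"
      using int_char by simp
    have "(\<lambda>n. std_gauss ((1 / real (Suc n)) *\<^sub>R \<xi>)) \<longlonglongrightarrow> std_gauss (0::'a)" for \<xi> :: 'a
    proof (rule continuous_on_tendsto_compose[OF continuous_std_gauss])
      have "(\<lambda>n. (1 / real (Suc n)) *\<^sub>R \<xi>) \<longlonglongrightarrow> 0 *\<^sub>R \<xi>"
        by (intro tendsto_scaleR tendsto_const LIMSEQ_Suc[OF lim_1_over_n])
      then show "(\<lambda>n. (1 / real (Suc n)) *\<^sub>R \<xi>) \<longlonglongrightarrow> 0" by simp
    qed auto
    then show "AE \<xi> in lborel. (\<lambda>n. iexp (- (\<xi> \<bullet> x)) * char_fun N \<xi> *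
          complex_of_real (std_gauss ((1 / real (Suc n)) *\<^sub>R \<xi>)))
        \<longlonglongrightarrow> iexp (- (\<xi> \<bullet> x)) * char_fun N \<xi> * complex_of_real (std_gauss (0::'a))"
      by (intro AE_I2 tendsto_mult tendsto_const tendsto_of_real)
  qed measurable
  from tendsto_mult[OF tendsto_const[of "complex_of_real ?c"] this]
  have "(\<lambda>n. complex_of_real (gauss_smooth N (real (Suc n)) x)) \<longlonglongrightarrow>
    ?c * (\<integral>\<xi>. iexp (- (\<xi> \<bullet> x)) * char_fun N \<xi> * complex_of_real (std_gauss (0::'a)) \<partial>lborel)"
    by (simp only: gauss_smooth_fourier of_nat_0_less_iff zero_less_Suc)
  also have "?c * (\<integral>\<xi>. iexp (- (\<xi> \<bullet> x)) * char_fun N \<xi> * complex_of_real (std_gauss (0::'a)) \<partial>lborel)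
     = inv_fourier N x"
  proof -
    have c: "complex_of_real ((2 * pi) powr (- real DIM('a))) = complex_of_real ?c * complex_of_real ?c"
      unfolding of_real_mult[symmetric] powr_add[symmetric] by simp
    have g0: "std_gauss (0::'a) = ?c" by (simp add: std_gauss_def)
    show ?thesis
      unfolding inv_fourier_def c g0 by (simp only: integral_mult_left_zero) (simp only: mult_ac)
  qed
  finally show ?thesis .
qed

lemma inv_fourier_nonneg: "0 \<le> Re (inv_fourier N x)"
  and inv_fourier_real: "Im (inv_fourier N x) = 0"
  and tendsto_gauss_smooth: "(\<lambda>n. gauss_smooth N (real (Suc n)) x) \<longlonglongrightarrow> Re (inv_fourier N x)"
proof -
  show *: "(\<lambda>n. gauss_smooth N (real (Suc n)) x) \<longlonglongrightarrow> Re (inv_fourier N x)"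
    using tendsto_Re[OF tendsto_gauss_smooth_complex[of x]] by simp
  show "0 \<le> Re (inv_fourier N x)"
    by (rule LIMSEQ_le_const[OF *]) (intro exI allI impI gauss_smooth_nonneg, simp)
  show "Im (inv_fourier N x) = 0"
    using tendsto_Im[OF tendsto_gauss_smooth_complex[of x]] by (simp add: LIMSEQ_const_iff)
qed

lemma inv_fourier_le:
  "Re (inv_fourier N x) \<le> (2 * pi) powr (- real DIM('a)) * (\<integral>\<xi>. norm (char_fun N \<xi>) \<partial>lborel)"
  by (rule LIMSEQ_le_const2[OF tendsto_gauss_smooth]) (auto intro!: gauss_smooth_le)

lemma continuous_inv_fourier: "continuous_on UNIV (inv_fourier N)"
proof (rule continuous_at_imp_continuous_on, intro ballI, unfold continuous_at_sequentially o_def, intro allI impI)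
  fix x and u :: "nat \<Rightarrow> 'a" assume u: "u \<longlonglongrightarrow> x"
  show "(\<lambda>n. inv_fourier N (u n)) \<longlonglongrightarrow> inv_fourier N x"
    unfolding inv_fourier_def
  proof (intro tendsto_mult tendsto_const integral_dominated_convergence[where w = "\<lambda>\<xi>. norm (char_fun N \<xi>)"])
    show "AE \<xi> in lborel. (\<lambda>n. iexp (- (\<xi> \<bullet> u n)) * char_fun N \<xi>) \<longlonglongrightarrow> iexp (- (\<xi> \<bullet> x)) * char_fun N \<xi>"
      using u by (intro AE_I2 tendsto_intros)
  qed (use int_char in \<open>auto simp: norm_mult\<close>)
qed

lemma borel_measurable_inv_fourier [measurable]: "inv_fourier N \<in> borel_measurable borel"
  by (intro borel_measurable_continuous_onI continuous_inv_fourier)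

text \<open>The integral of f against the smoothed density is taken to the limit in two ways.
  Pointwise convergence under the uniform bound gives the right side; moving the Gaussian average
  onto f, where it is an approximate identity, gives the left side.\<close>

lemma integral_eq_inv_fourier:
  fixes f :: "'a \<Rightarrow> real"
  assumes f: "continuous_on UNIV f" "\<And>x. 0 \<le> f x" "\<And>x. f x \<le> 1" "integrable lborel f"
  shows "(\<integral>x. f x \<partial>N) = (\<integral>x. f x * Re (inv_fourier N x) \<partial>lborel)"
proof (rule LIMSEQ_unique)
  have [measurable]: "f \<in> borel_measurable borel"
    by (intro borel_measurable_continuous_onI f)
  let ?C = "(2 * pi) powr (- real DIM('a)) * (\<integral>\<xi>. norm (char_fun N \<xi>) \<partial>lborel)"
  let ?K = "\<lambda>n. real (Suc n)"
  show "(\<lambda>n. \<integral>x. f x * gauss_smooth N (?K n) x \<partial>lborel) \<longlonglongrightarrow> (\<integral>x. f x * Re (inv_fourier N x) \<partial>lborel)"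
  proof (rule integral_dominated_convergence[where w = "\<lambda>x. f x * ?C"])
    show "integrable lborel (\<lambda>x. f x * ?C)" using f(4) by simp
    show "AE x in lborel. (\<lambda>n. f x * gauss_smooth N (?K n) x) \<longlonglongrightarrow> f x * Re (inv_fourier N x)"
      by (intro AE_I2 tendsto_mult tendsto_const tendsto_gauss_smooth)
    show "AE x in lborel. norm (f x * gauss_smooth N (?K n) x) \<le> f x * ?C" for n
      using f(2) gauss_smooth_nonneg[of "?K n"] gauss_smooth_le[of "?K n"]
      by (intro AE_I2) (auto simp: abs_mult intro!: mult_left_mono simp del: of_nat_Suc)
  qed measurable
  \<comment> \<open>After Fubini, the substitution x = y - z / k has Jacobian k^(-d), which cancels
    the normalization of the smoothing.\<close>
  have eq: "(\<integral>x. f x * gauss_smooth N (?K n) x \<partial>lborel) =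
     (\<integral>y. (\<integral>z. f (y + (- (1 / ?K n)) *\<^sub>R z) * std_gauss z \<partial>lborel) \<partial>N)" for n
  proof -
    interpret pair_sigma_finite N "lborel :: 'a measure" ..
    define k where "k = ?K n"
    have k: "k > 0" by (simp add: k_def)
    define h where "h y x = f x * (k ^ DIM('a) * std_gauss (k *\<^sub>R (y - x)))" for x y
    have [measurable]: "case_prod h \<in> borel_measurable (N \<Otimes>\<^sub>M lborel)"
      unfolding h_def by measurable
    have int: "integrable (N \<Otimes>\<^sub>M lborel) (case_prod h)"
    proof (rule Bochner_Integration.integrable_bound)
      let ?D = "k ^ DIM('a) * (2 * pi) powr (- real DIM('a) / 2)"
      show "integrable (N \<Otimes>\<^sub>M lborel) (\<lambda>(y, x). f x * ?D)"
        using f(2,4) by (intro Fubini_integrable) (auto simp: abs_mult)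
      show "AE p in N \<Otimes>\<^sub>M lborel. norm (case_prod h p) \<le> norm (case p of (y, x) \<Rightarrow> f x * ?D)"
      proof (rule AE_I2)
        fix p :: "'a \<times> 'a"
        show "norm (case_prod h p) \<le> norm (case p of (y, x) \<Rightarrow> f x * ?D)"
          using f(2)[of "snd p"] k
            mult_left_mono[OF std_gauss_le[of "k *\<^sub>R (fst p - snd p)"], of "f (snd p) * k ^ DIM('a)"]
          by (simp add: h_def abs_mult std_gauss_pos less_imp_le split_beta mult_ac)
      qed
    qed measurable
    have "(\<integral>x. f x * gauss_smooth N k x \<partial>lborel) = (\<integral>x. (\<integral>y. h y x \<partial>N) \<partial>lborel)"
      by (simp add: gauss_smooth_def h_def)
    also have "\<dots> = (\<integral>y. (\<integral>x. h y x \<partial>lborel) \<partial>N)"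
      using Fubini_integral[OF int] by simp
    also have "(\<lambda>y. \<integral>x. h y x \<partial>lborel) = (\<lambda>y. \<integral>z. f (y + (- (1 / k)) *\<^sub>R z) * std_gauss z \<partial>lborel)"
    proof
      fix y
      have "(\<integral>x. h y x \<partial>lborel) = \<bar>- (1 / k)\<bar> ^ DIM('a) *\<^sub>R (\<integral>z. h y (y + (- (1 / k)) *\<^sub>R z) \<partial>lborel)"
        using k by (intro lborel_integral_affine(1)) (auto simp: h_def)
      also have "\<dots> = (\<integral>z. f (y + (- (1 / k)) *\<^sub>R z) * std_gauss z \<partial>lborel)"
        using k by (simp add: h_def power_one_over mult.left_commute[of _ "k ^ DIM('a)"])
      finally show "(\<integral>x. h y x \<partial>lborel) = (\<integral>z. f (y + (- (1 / k)) *\<^sub>R z) * std_gauss z \<partial>lborel)" .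
    qed
    finally show ?thesis by (simp add: k_def)
  qed
  show "(\<lambda>n. \<integral>x. f x * gauss_smooth N (?K n) x \<partial>lborel) \<longlonglongrightarrow> (\<integral>x. f x \<partial>N)"
    unfolding eq
  proof (rule integral_dominated_convergence[where w = "\<lambda>_. 1"])
    have le: "\<bar>f x * std_gauss z\<bar> \<le> std_gauss z" for x and z :: 'a
      using f(2)[of x] f(3)[of x] std_gauss_pos[of z] by (simp add: abs_mult mult_left_le_one_le)
    have "(\<lambda>n. \<integral>z. f (y + (- (1 / ?K n)) *\<^sub>R z) * std_gauss z \<partial>lborel) \<longlonglongrightarrow> (\<integral>z. f y * std_gauss (z :: 'a) \<partial>lborel)" for y
    proof (rule integral_dominated_convergence[where w = std_gauss])
      show "AE z in lborel. (\<lambda>n. f (y + (- (1 / ?K n)) *\<^sub>R z) * std_gauss z) \<longlonglongrightarrow> f y * std_gauss z"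
      proof (intro AE_I2 tendsto_mult tendsto_const continuous_on_tendsto_compose[OF f(1)])
        fix z :: 'a
        have "(\<lambda>n. y + (- (1 / ?K n)) *\<^sub>R z) \<longlonglongrightarrow> y + (- 0) *\<^sub>R z"
          by (intro tendsto_add tendsto_minus tendsto_scaleR tendsto_const LIMSEQ_Suc[OF lim_1_over_n])
        then show "(\<lambda>n. y + (- (1 / ?K n)) *\<^sub>R z) \<longlonglongrightarrow> y" by simp
      qed auto
    qed (auto simp: integrable_std_gauss le simp del: of_nat_Suc)
    then show "AE y in N. (\<lambda>n. \<integral>z. f (y + (- (1 / ?K n)) *\<^sub>R z) * std_gauss z \<partial>lborel) \<longlonglongrightarrow> f y"
      by (simp add: integral_std_gauss del: of_nat_Suc)
    show "AE y in N. norm (\<integral>z. f (y + (- (1 / ?K n)) *\<^sub>R z) * std_gauss z \<partial>lborel) \<le> 1" for n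
    proof (rule AE_I2)
      fix y
      have "norm (\<integral>z. f (y + (- (1 / ?K n)) *\<^sub>R z) * std_gauss z \<partial>lborel) \<le> (\<integral>z. std_gauss (z::'a) \<partial>lborel)"
        by (rule Bochner_Integration.integral_norm_bound_integral)
          (auto simp: integrable_std_gauss le intro!: AE_I2
            Bochner_Integration.integrable_bound[OF integrable_std_gauss] order_trans[OF le] simp del: of_nat_Suc)
      then show "norm (\<integral>z. f (y + (- (1 / ?K n)) *\<^sub>R z) * std_gauss z \<partial>lborel) \<le> 1"
        by (simp add: integral_std_gauss)
    qed
  qed (auto simp: simp del: of_nat_Suc)
qed

text \<open>Open boxes form a generating system closed under intersection. The indicator of a box is
  a limit of continuous functions below it, for which \<open>integral_eq_inv_fourier\<close> is
  available.\<close>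

theorem fourier_inversion: "N = density lborel (\<lambda>x. ennreal (Re (inv_fourier N x)))"
proof (rule measure_eqI_generator_eq)
  let ?E = "range (\<lambda>(a, b). box a b :: 'a set)"
  let ?C = "(2 * pi) powr (- real DIM('a)) * (\<integral>\<xi>. norm (char_fun N \<xi>) \<partial>lborel)"
  show "Int_stable ?E"
    by (auto simp: Int_stable_def box_Int_box)
  show "?E \<subseteq> Pow UNIV" "sets N = sigma_sets UNIV ?E"
       "sets (density lborel (\<lambda>x. ennreal (Re (inv_fourier N x)))) = sigma_sets UNIV ?E"
    by (simp_all add: borel_eq_box)
  let ?A = "\<lambda>n::nat. box (- (real n *\<^sub>R One)) (real n *\<^sub>R One) :: 'a set"
  show "range ?A \<subseteq> ?E" "(\<Union>i. ?A i) = UNIV"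
    unfolding UN_box_eq_UNIV by auto
  show "emeasure N (?A i) \<noteq> \<infinity>" for i by simp
  fix X assume "X \<in> ?E"
  then obtain a b where X: "X = box a b" by auto
  have [measurable]: "X \<in> sets borel" by (simp add: X)
  \<comment> \<open>\<open>infdist\<close> to the empty set is 0 by convention, so positivity of the
    distance inside X requires a nonempty complement.\<close>
  have ne: "- X \<noteq> {}"
    using bounded_box[of a b] not_bounded_UNIV[where 'a = 'a] by (metis X double_complement Compl_empty_eq)
  have cl: "closed (- X)" unfolding X by (intro closed_Compl open_box)
  define f where "f n x = min 1 (real n * infdist x (- X))" for n x
  have cont: "continuous_on UNIV (f n)" for n
    unfolding f_def by (intro continuous_intros continuous_on_infdist)
  have [measurable]: "f n \<in> borel_measurable borel" for n
    by (intro borel_measurable_continuous_onI cont)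
  have f01: "0 \<le> f n x" "f n x \<le> 1" for n x
    by (auto simp: f_def infdist_nonneg)
  have f_le: "f n x \<le> indicator X x" for n x
    using f01[of n x] ne by (auto simp: f_def indicator_def infdist_zero)
  have fin: "emeasure lborel X < \<infinity>"
    unfolding X by (rule emeasure_lborel_box_finite)
  have int_X: "integrable lborel (indicator X :: 'a \<Rightarrow> real)"
    using fin by (simp add: integrable_indicator_iff)
  have f_int: "integrable lborel (f n)" for n
    by (rule Bochner_Integration.integrable_bound[OF int_X]) (use f01 f_le in \<open>auto simp: abs_of_nonneg\<close>)
  have lim: "(\<lambda>n. f n x) \<longlonglongrightarrow> indicator X x" for x
  proof (cases "x \<in> X")
    case True
    then have "infdist x (- X) > 0"
      using cl ne by (metis ComplD in_closed_iff_infdist_zero infdist_nonneg less_eq_real_def)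
    then have "filterlim (\<lambda>n. real n * infdist x (- X)) at_top sequentially"
      by (intro filterlim_at_top_mult_tendsto_pos[OF tendsto_const _ filterlim_real_sequentially])
    then have "eventually (\<lambda>n. real n * infdist x (- X) \<ge> 1) sequentially"
      by (simp add: filterlim_at_top)
    then have "eventually (\<lambda>n. f n x = 1) sequentially"
      by eventually_elim (simp add: f_def)
    then show ?thesis using True by (simp add: tendsto_eventually)
  next
    case False
    then show ?thesis by (simp add: f_def infdist_zero)
  qed
  have l1: "(\<lambda>n. \<integral>x. f n x \<partial>N) \<longlonglongrightarrow> (\<integral>x. indicator X x \<partial>N)"
    by (rule integral_dominated_convergence[where w = "\<lambda>_. 1"]) (use lim f01 in auto)
  have l2: "(\<lambda>n. \<integral>x. f n x \<partial>N) \<longlonglongrightarrow> (\<integral>x. indicator X x * Re (inv_fourier N x) \<partial>lborel)"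
    unfolding integral_eq_inv_fourier[OF cont f01 f_int]
  proof (rule integral_dominated_convergence[where w = "\<lambda>x. indicator X x * ?C"])
    show "integrable lborel (\<lambda>x. indicator X x * ?C)" using int_X by simp
    show "AE x in lborel. norm (f n x * Re (inv_fourier N x)) \<le> indicator X x * ?C" for n
      using f_le f01 inv_fourier_nonneg inv_fourier_le
      by (intro AE_I2) (auto simp: abs_mult intro!: mult_mono)
  qed (auto intro!: tendsto_mult lim)
  have eq: "measure N X = (\<integral>x. indicator X x * Re (inv_fourier N x) \<partial>lborel)"
    using LIMSEQ_unique[OF l1 l2] by simp
  have int: "integrable lborel (\<lambda>x. indicator X x * Re (inv_fourier N x))"
  proof (rule Bochner_Integration.integrable_bound)
    show "integrable lborel (\<lambda>x. indicator X x * ?C)" using int_X by simp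
    show "AE x in lborel. norm (indicator X x * Re (inv_fourier N x)) \<le> norm (indicator X x * ?C)"
      using inv_fourier_nonneg inv_fourier_le
      by (intro AE_I2) (auto simp: indicator_def intro: order_trans[OF _ abs_ge_self])
  qed measurable
  have "emeasure (density lborel (\<lambda>x. ennreal (Re (inv_fourier N x)))) X =
      (\<integral>\<^sup>+x. ennreal (indicator X x * Re (inv_fourier N x)) \<partial>lborel)"
    by (subst emeasure_density) (auto intro!: nn_integral_cong simp: indicator_def)
  also have "\<dots> = ennreal (measure N X)"
    unfolding eq by (rule nn_integral_eq_integral[OF int]) (simp add: inv_fourier_nonneg)
  finally show "emeasure N X = emeasure (density lborel (\<lambda>x. ennreal (Re (inv_fourier N x)))) X"
    by (simp add: emeasure_eq_measure)
qed

end

end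

section \<open>The characteristic function\<close>

text \<open>Nonnegativity makes n-th roots unique, which fixes H at 1/n; multiplicativity extends
  this to positive rationals, and continuity to all t.\<close>

lemma multiplicative_eq_exp:
  fixes H :: "real \<Rightarrow> real"
  assumes cont: "continuous_on {0<..} H" and nonneg: "\<And>t. t > 0 \<Longrightarrow> H t \<ge> 0"
    and mult: "\<And>s t. s > 0 \<Longrightarrow> t > 0 \<Longrightarrow> H (s + t) = H s * H t"
    and H1: "H 1 = exp c" and t: "t > 0"
  shows "H t = exp (c * t)"
proof -
  have pow: "H (real (Suc n) * s) = H s ^ Suc n" if "s > 0" for n s
  proof (induction n)
    case (Suc n)
    have "H (real (Suc (Suc n)) * s) = H (s + real (Suc n) * s)"
      by (simp add: algebra_simps)
    also have "\<dots> = H s * H (real (Suc n) * s)"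
      using that by (intro mult) auto
    finally show ?case using Suc by simp
  qed simp
  have inv: "H (1 / real (Suc n)) = exp (c / real (Suc n))" for n
  proof (rule power_eq_imp_eq_base)
    have "H (1 / real (Suc n)) ^ Suc n = exp c"
      using pow[of "1 / real (Suc n)" n] H1 by simp
    also have "\<dots> = exp (c / real (Suc n)) ^ Suc n"
      by (simp only: exp_of_nat_mult[symmetric]) simp
    finally show "H (1 / real (Suc n)) ^ Suc n = exp (c / real (Suc n)) ^ Suc n" .
  qed (auto intro: nonneg)
  have rat: "H (real (Suc m) / real (Suc n)) = exp (c * (real (Suc m) / real (Suc n)))" for m n
  proof -
    have "H (real (Suc m) / real (Suc n)) = H (1 / real (Suc n)) ^ Suc m"
      using pow[of "1 / real (Suc n)" m] by simp
    also have "\<dots> = exp (real (Suc m) * (c / real (Suc n)))"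
      unfolding inv by (simp only: exp_of_nat_mult)
    finally show ?thesis by (simp add: mult.commute)
  qed
  \<comment> \<open>Rationals approaching t from above; rounding up keeps the numerator positive, as
    \<open>rat\<close> demands.\<close>
  define q where "q n = real (Suc (nat \<lfloor>t * real (Suc n)\<rfloor>)) / real (Suc n)" for n
  have "(\<lambda>n. q n - t) \<longlonglongrightarrow> 0"
  proof (rule tendsto_sandwich[OF _ _ tendsto_const LIMSEQ_Suc[OF lim_1_over_n]])
    have "0 \<le> q n - t \<and> q n - t \<le> 1 / real (Suc n)" for n
    proof -
      have "real (nat \<lfloor>t * real (Suc n)\<rfloor>) = real_of_int \<lfloor>t * real (Suc n)\<rfloor>"
        using t by simp
      then have "t * real (Suc n) \<le> real (Suc (nat \<lfloor>t * real (Suc n)\<rfloor>))"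
          "real (Suc (nat \<lfloor>t * real (Suc n)\<rfloor>)) \<le> t * real (Suc n) + 1"
        by linarith+
      moreover have "q n - t = (real (Suc (nat \<lfloor>t * real (Suc n)\<rfloor>)) - t * real (Suc n)) / real (Suc n)"
        unfolding q_def by (subst diff_divide_distrib) simp
      ultimately show ?thesis by (simp add: divide_right_mono)
    qed
    then show "\<forall>\<^sub>F n in sequentially. 0 \<le> q n - t"
      "\<forall>\<^sub>F n in sequentially. q n - t \<le> 1 / real (Suc n)" by auto
  qed
  from tendsto_add[OF this tendsto_const[of t]] have q: "q \<longlonglongrightarrow> t" by simp
  have "(\<lambda>n. H (q n)) \<longlonglongrightarrow> H t"
    using t by (intro continuous_on_tendsto_compose[OF cont q])
      (auto simp: q_def simp del: of_nat_Suc intro!: divide_pos_pos)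
  moreover have "(\<lambda>n. H (q n)) \<longlonglongrightarrow> exp (c * t)"
    unfolding q_def rat using q unfolding q_def by (intro tendsto_intros)
  ultimately show ?thesis by (rule LIMSEQ_unique)
qed

lemma continuous_char_fun:
  fixes N :: "'a::euclidean_space measure"
  assumes "finite_measure N" and [measurable_cong]: "sets N = sets borel"
  shows "continuous_on UNIV (char_fun N)"
proof (rule continuous_at_imp_continuous_on, intro ballI, unfold continuous_at_sequentially o_def, intro allI impI)
  interpret finite_measure N by fact
  fix \<xi> and u :: "nat \<Rightarrow> 'a" assume u: "u \<longlonglongrightarrow> \<xi>"
  show "(\<lambda>n. char_fun N (u n)) \<longlonglongrightarrow> char_fun N \<xi>"
    unfolding char_fun_def
  proof (rule integral_dominated_convergence[where w = "\<lambda>_. 1"])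
    show "AE x in N. (\<lambda>n. iexp (u n \<bullet> x)) \<longlonglongrightarrow> iexp (\<xi> \<bullet> x)"
      using u by (intro AE_I2 tendsto_intros)
  qed auto
qed

text \<open>The reflection x to -x is orthogonal, so the characteristic function equals its own
  conjugate.\<close>

lemma char_fun_symmetric_real:
  fixes N :: "'a::euclidean_space measure"
  assumes [measurable_cong]: "sets N = sets borel" and sym: "spherically_symmetric N"
  shows "Im (char_fun N \<xi>) = 0"
proof -
  have "orthogonal_transformation (uminus :: 'a \<Rightarrow> 'a)"
    by (auto simp: orthogonal_transformation_def linear_iff)
  with sym have N: "distr N borel uminus = N"
    by (auto simp: spherically_symmetric_def)
  have "char_fun N \<xi> = (CLINT x|N. iexp (\<xi> \<bullet> (- x)))"
    unfolding char_fun_def by (subst N[symmetric], subst integral_distr) auto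
  also have "\<dots> = (CLINT x|N. cnj (iexp (\<xi> \<bullet> x)))"
    by (intro Bochner_Integration.integral_cong refl) (simp add: exp_cnj)
  also have "\<dots> = cnj (char_fun N \<xi>)"
    unfolding char_fun_def by (rule Bochner_Integration.integral_cnj)
  finally show ?thesis by (metis Reals_cnj_iff complex_is_Real_iff)
qed

text \<open>The shift c in the definition of stability contributes only a phase, which disappears on
  taking moduli.\<close>

lemma char_fun_stable:
  fixes N :: "'a::euclidean_space measure"
  assumes "prob_space N" and [measurable_cong]: "sets N = sets borel"
    and st: "stable_law \<alpha> N" and ab: "a > 0" "b > 0"
  shows "norm (char_fun N (a *\<^sub>R \<xi>)) * norm (char_fun N (b *\<^sub>R \<xi>)) =
    norm (char_fun N ((a powr \<alpha> + b powr \<alpha>) powr (1 / \<alpha>) *\<^sub>R \<xi>))"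
proof -
  interpret N: prob_space N by fact
  interpret P: pair_prob_space N N ..
  define s where "s = (a powr \<alpha> + b powr \<alpha>) powr (1 / \<alpha>)"
  obtain c where c: "distr (N \<Otimes>\<^sub>M N) borel (\<lambda>(x, y). a *\<^sub>R x + b *\<^sub>R y) =
      distr N borel (\<lambda>x. s *\<^sub>R x + c)"
    using st ab unfolding stable_law_def s_def by blast
  have eq: "iexp (\<xi> \<bullet> (a *\<^sub>R x + b *\<^sub>R y)) = iexp ((a *\<^sub>R \<xi>) \<bullet> x) * iexp ((b *\<^sub>R \<xi>) \<bullet> y)" for x y
    by (simp add: exp_add[symmetric] algebra_simps)
  have "(CLINT z|distr (N \<Otimes>\<^sub>M N) borel (\<lambda>(x, y). a *\<^sub>R x + b *\<^sub>R y). iexp (\<xi> \<bullet> z)) =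
      (CLINT (x, y)|N \<Otimes>\<^sub>M N. iexp ((a *\<^sub>R \<xi>) \<bullet> x) * iexp ((b *\<^sub>R \<xi>) \<bullet> y))"
    by (subst integral_distr) (auto simp: split_beta' eq intro!: Bochner_Integration.integral_cong)
  also have "\<dots> = (CLINT x|N. CLINT y|N. iexp ((a *\<^sub>R \<xi>) \<bullet> x) * iexp ((b *\<^sub>R \<xi>) \<bullet> y))"
    using P.integral_fst'[OF P.P.integrable_const_bound[where B = 1 and
      f = "\<lambda>(x, y). iexp ((a *\<^sub>R \<xi>) \<bullet> x) * iexp ((b *\<^sub>R \<xi>) \<bullet> y)"]]
    by (simp add: split_beta' norm_mult)
  also have "\<dots> = char_fun N (a *\<^sub>R \<xi>) * char_fun N (b *\<^sub>R \<xi>)"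
    unfolding char_fun_def by simp
  finally have 1: "(CLINT z|distr (N \<Otimes>\<^sub>M N) borel (\<lambda>(x, y). a *\<^sub>R x + b *\<^sub>R y). iexp (\<xi> \<bullet> z)) =
      char_fun N (a *\<^sub>R \<xi>) * char_fun N (b *\<^sub>R \<xi>)" .
  have "(CLINT z|distr N borel (\<lambda>x. s *\<^sub>R x + c). iexp (\<xi> \<bullet> z)) =
      (CLINT x|N. iexp (\<xi> \<bullet> c) * iexp ((s *\<^sub>R \<xi>) \<bullet> x))"
    by (subst integral_distr)
      (auto simp: exp_add[symmetric] algebra_simps intro!: Bochner_Integration.integral_cong)
  also have "\<dots> = iexp (\<xi> \<bullet> c) * char_fun N (s *\<^sub>R \<xi>)"
    unfolding char_fun_def by simp
  finally have "char_fun N (a *\<^sub>R \<xi>) * char_fun N (b *\<^sub>R \<xi>) = iexp (\<xi> \<bullet> c) * char_fun N (s *\<^sub>R \<xi>)"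
    using 1 c by simp
  then have "norm (char_fun N (a *\<^sub>R \<xi>) * char_fun N (b *\<^sub>R \<xi>)) = norm (iexp (\<xi> \<bullet> c) * char_fun N (s *\<^sub>R \<xi>))"
    by simp
  then show ?thesis by (simp add: norm_mult s_def)
qed

theorem char_fun_symmetric_stable:
  fixes N :: "'a::euclidean_space measure"
  assumes N: "prob_space N" "sets N = sets borel" and \<alpha>: "0 < \<alpha>"
    and sym: "spherically_symmetric N" and st: "stable_law \<alpha> N" and unit: "unit_scale N"
  shows "char_fun N \<xi> = of_real (exp (- (norm \<xi> powr \<alpha>)))"
proof -
  interpret N: prob_space N by fact
  have cont: "continuous_on UNIV (char_fun N)"
    by (rule continuous_char_fun) (use N in \<open>auto intro: N.finite_measure_axioms\<close>)
  have at_0: "char_fun N 0 = 1"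
    by (simp add: char_fun_def N.prob_space)
  have norm_eq: "norm (char_fun N \<xi>) = exp (- (norm \<xi> powr \<alpha>))" for \<xi>
  proof (cases "\<xi> = 0")
    case True
    then show ?thesis using at_0 \<alpha> by simp
  next
    case False
    define u where "u = \<xi> /\<^sub>R norm \<xi>"
    have u: "norm u = 1" "\<xi> = norm \<xi> *\<^sub>R u" using False by (auto simp: u_def)
    \<comment> \<open>In the variable t = r^\<alpha> the combination (a^\<alpha> +
      b^\<alpha>)^(1/\<alpha>) of radii becomes ordinary addition.\<close>
    define H where "H t = norm (char_fun N (t powr (1 / \<alpha>) *\<^sub>R u))" for t
    have "H (norm \<xi> powr \<alpha>) = exp ((-1) * (norm \<xi> powr \<alpha>))"
    proof (rule multiplicative_eq_exp)
      show "continuous_on {0<..} H"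
        unfolding H_def
        by (intro continuous_intros continuous_on_compose2[OF cont]) auto
      show "H (s + t) = H s * H t" if "s > 0" "t > 0" for s t
        using char_fun_stable[OF N st, of "s powr (1 / \<alpha>)" "t powr (1 / \<alpha>)" u] that \<alpha>
        by (simp add: H_def powr_powr)
      show "H 1 = exp (-1)"
        using unit u by (simp add: H_def unit_scale_def)
    qed (use False in \<open>auto simp: H_def\<close>)
    then show ?thesis using u(2) \<alpha> False by (simp add: H_def powr_powr)
  qed
  have real: "char_fun N \<xi> = of_real (Re (char_fun N \<xi>))" for \<xi>
    using char_fun_symmetric_real[OF N(2) sym] by (simp add: complex_eq_iff)
  \<comment> \<open>The modulus leaves only the sign open. A negative value would force a zero on
    the segment from the origin, where the value is 1, but the modulus never vanishes.\<close>
  have "0 \<le> Re (char_fun N \<xi>)"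
  proof (rule ccontr)
    assume neg: "\<not> 0 \<le> Re (char_fun N \<xi>)"
    have "\<exists>t. 0 \<le> t \<and> t \<le> 1 \<and> Re (char_fun N (t *\<^sub>R \<xi>)) = 0"
    proof (rule IVT2')
      show "continuous_on {0..1} (\<lambda>t. Re (char_fun N (t *\<^sub>R \<xi>)))"
        by (intro continuous_intros continuous_on_compose2[OF cont]) auto
    qed (use neg at_0 in auto)
    then obtain t where "Re (char_fun N (t *\<^sub>R \<xi>)) = 0" by auto
    then have "norm (char_fun N (t *\<^sub>R \<xi>)) = 0" by (subst real) simp
    then show False unfolding norm_eq by simp
  qed
  then show ?thesis
    using norm_eq[of \<xi>] real[of \<xi>] by (metis abs_of_nonneg norm_of_real)
qed

section \<open>Gamma integrals in logarithmic coordinates\<close>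

text \<open>Polar coordinates for radial functions. With the minus sign the half-line
  \<open>{a<..}\<close> corresponds to the ball of radius exp (- a), up to the origin; its volume is
  finite, so comparing the two measures on such half-lines suffices.\<close>

lemma distr_lborel_neg_ln_norm:
  "distr lborel borel (\<lambda>x::'a::euclidean_space. - ln (norm x)) =
    density lborel (\<lambda>y. ennreal (DIM('a) * unit_ball_vol DIM('a) * exp (- (DIM('a) * y))))"
  (is "?L = ?R")
proof (rule measure_eqI_lessThan)
  let ?d = "real DIM('a)"
  fix a :: real
  have "emeasure ?L {a<..} = emeasure lborel {x::'a. a < - ln (norm x)}"
    by (subst emeasure_distr) (auto simp: vimage_def)
  also have "\<dots> = emeasure lborel (ball (0::'a) (exp (- a)))"
  proof (rule emeasure_eq_AE)
    show "AE x::'a in lborel. (x \<in> {x. a < - ln (norm x)}) = (x \<in> ball 0 (exp (- a)))"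
      using AE_lborel_singleton[of 0]
    proof eventually_elim
      case (elim x)
      then have "norm x < exp (- a) \<longleftrightarrow> ln (norm x) < - a"
        by (metis exp_less_cancel_iff exp_ln zero_less_norm_iff)
      then show ?case by auto
    qed
  qed auto
  also have "\<dots> = ennreal (unit_ball_vol ?d * exp (- a) ^ DIM('a))"
    by (rule emeasure_ball) simp
  also have "\<dots> = ennreal (unit_ball_vol ?d * exp (- (?d * a)))"
    by (simp add: exp_of_nat_mult[symmetric])
  finally have L: "emeasure ?L {a<..} = ennreal (unit_ball_vol ?d * exp (- (?d * a)))" .
  then show "emeasure ?L {a<..} < \<infinity>" by simp
  have "emeasure ?R {a<..} = (\<integral>\<^sup>+y. ennreal (?d * unit_ball_vol ?d * exp (- (?d * y))) * indicator {a<..} y \<partial>lborel)"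
    by (subst emeasure_density) auto
  also have "\<dots> = (\<integral>\<^sup>+y. ennreal (?d * unit_ball_vol ?d * exp (- (?d * y))) * indicator {a..} y \<partial>lborel)"
    using AE_lborel_singleton[of a]
    by (intro nn_integral_cong_AE, eventually_elim) (auto simp: indicator_def)
  also have "\<dots> = ennreal (0 - (- unit_ball_vol ?d * exp (- (?d * a))))"
  proof (rule nn_integral_FTC_atLeast)
    show "((\<lambda>y. - unit_ball_vol ?d * exp (- (?d * y))) \<longlongrightarrow> 0) at_top"
      by (intro tendsto_mult_right_zero filterlim_compose[OF exp_at_bot]
        filterlim_compose[OF filterlim_uminus_at_bot_at_top] filterlim_tendsto_pos_mult_at_top[OF tendsto_const]
        filterlim_ident) auto
  qed (auto intro!: derivative_eq_intros)
  finally show "emeasure ?L {a<..} = emeasure ?R {a<..}"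
    unfolding L by simp
qed auto

lemma lborel_integral_neg_ln_norm:
  fixes f :: "real \<Rightarrow> 'b::{banach, second_countable_topology}"
  assumes [measurable]: "f \<in> borel_measurable borel"
  defines "w \<equiv> \<lambda>y::real. real DIM('a) * unit_ball_vol DIM('a) * exp (- (DIM('a) * y))"
  shows "(\<integral>x. f (- ln (norm x)) \<partial>(lborel :: 'a::euclidean_space measure)) = (\<integral>y. w y *\<^sub>R f y \<partial>lborel)"
    and "integrable (lborel :: 'a measure) (\<lambda>x. f (- ln (norm x))) \<longleftrightarrow> integrable lborel (\<lambda>y. w y *\<^sub>R f y)"
proof -
  have "(\<integral>x. f (- ln (norm x)) \<partial>(lborel :: 'a measure)) =
      integral\<^sup>L (distr (lborel :: 'a measure) borel (\<lambda>x. - ln (norm x))) f"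
    by (subst integral_distr) auto
  also have "\<dots> = (\<integral>y. w y *\<^sub>R f y \<partial>lborel)"
    unfolding distr_lborel_neg_ln_norm w_def
    by (subst integral_density) auto
  finally show "(\<integral>x. f (- ln (norm x)) \<partial>(lborel :: 'a measure)) = (\<integral>y. w y *\<^sub>R f y \<partial>lborel)" .
  have "integrable (lborel :: 'a measure) (\<lambda>x. f (- ln (norm x))) \<longleftrightarrow>
      integrable (distr (lborel :: 'a measure) borel (\<lambda>x. - ln (norm x))) f"
    by (subst integrable_distr_eq) auto
  also have "\<dots> \<longleftrightarrow> integrable lborel (\<lambda>y. w y *\<^sub>R f y)"
    unfolding distr_lborel_neg_ln_norm w_def
    by (subst integrable_density) auto
  finally show "integrable (lborel :: 'a measure) (\<lambda>x. f (- ln (norm x))) \<longleftrightarrow> integrable lborel (\<lambda>y. w y *\<^sub>R f y)" .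
qed

text \<open>Euler's integral under t = exp (- y). The substitution is the one-dimensional case of
  the radial formula, which integrates over both signs of t.\<close>

lemma Gamma_integral_exp:
  fixes w :: complex
  assumes w: "Re w > 0"
  shows "integrable lborel (\<lambda>y. exp (- (w * of_real y)) * of_real (exp (- exp (- y))))"
    and "(\<integral>y. exp (- (w * of_real y)) * of_real (exp (- exp (- y))) \<partial>lborel) = Gamma w"
proof -
  define g where "g t = indicator {0<..} t *\<^sub>R (complex_of_real t powr (w - 1) / of_real (exp t))" for t
  have [measurable]: "g \<in> borel_measurable borel"
  proof -
    have "continuous_on {0<..} (\<lambda>t. complex_of_real t powr (w - 1) / of_real (exp t))"
      by (intro continuous_intros) auto
    then have "set_borel_measurable borel {0<..} (\<lambda>t. complex_of_real t powr (w - 1) / of_real (exp t))"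
      by (intro borel_measurable_continuous_on_indicator[folded set_borel_measurable_def]) auto
    then show ?thesis by (simp add: set_borel_measurable_def g_def[abs_def])
  qed
  have "integrable lebesgue g"
    using absolutely_integrable_Gamma_integral'[OF w]
    by (simp add: g_def[abs_def] set_integrable_def)
  then have g: "integrable lborel g" by (simp add: integrable_completion)
  have "(g has_integral integral\<^sup>L lborel g) UNIV"
    by (rule has_integral_integral_lborel[OF g])
  moreover have "(g has_integral Gamma w) UNIV"
  proof -
    have "((\<lambda>t. if t \<in> {0<..} then complex_of_real t powr (w - 1) / of_real (exp t) else 0) has_integral Gamma w) UNIV"
      using Gamma_integral_complex'[OF w] by (simp only: has_integral_restrict_UNIV)
    then show ?thesis by (rule has_integral_eq[rotated]) (simp add: g_def)
  qed
  ultimately have Ig: "integral\<^sup>L lborel g = Gamma w"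
    by (rule has_integral_unique)
  have g': "integrable lborel (\<lambda>t. g (- t))" "(\<integral>t. g (- t) \<partial>lborel) = Gamma w"
    using lborel_integral_affine[of "-1" g 0] g Ig by auto
  define f where "f y = exp (- ((w - 1) * of_real y)) * complex_of_real (exp (- exp (- y)))" for y
  have [measurable]: "f \<in> borel_measurable borel" unfolding f_def by measurable
  have Ln: "Ln (- complex_of_real t) = of_real (ln (- t))" if "t < 0" for t
    using Ln_of_real[of "- t"] that by simp
  \<comment> \<open>The even extension of Euler's integrand: each half-line contributes one copy,
    hence the factor 2 on both sides below.\<close>
  have eq: "AE t in lborel. f (- ln (norm t)) = g t + g (- t)"
    using AE_lborel_singleton[of 0]
    by eventually_elim
      (auto simp: f_def g_def powr_def Ln_of_real Ln exp_minus field_simps abs_if split: if_splits)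
  have int: "integrable lborel (\<lambda>t::real. f (- ln (norm t)))"
    by (subst integrable_cong_AE[OF _ _ eq]) (auto intro: g g')
  have "(\<integral>t. f (- ln (norm t)) \<partial>(lborel :: real measure)) = (\<integral>t. g t + g (- t) \<partial>lborel)"
    by (rule integral_cong_AE[OF _ _ eq]) auto
  also have "\<dots> = 2 * Gamma w" using g g' Ig by simp
  finally have "(\<integral>y. (2 * exp (- y)) *\<^sub>R f y \<partial>lborel) = 2 * Gamma w"
    by (subst (asm) lborel_integral_neg_ln_norm) (auto simp: unit_ball_vol_1)
  moreover have "integrable lborel (\<lambda>y. (2 * exp (- y)) *\<^sub>R f y)"
    using int by (subst (asm) lborel_integral_neg_ln_norm) (auto simp: unit_ball_vol_1)
  moreover have "(2 * exp (- y)) *\<^sub>R f y = 2 * (exp (- (w * of_real y)) * of_real (exp (- exp (- y))))" for y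
    by (simp add: f_def scaleR_conv_of_real exp_of_real[symmetric] exp_add[symmetric] algebra_simps del: exp_of_real)
  ultimately have int2: "integrable lborel (\<lambda>y. 2 * (exp (- (w * of_real y)) * complex_of_real (exp (- exp (- y)))))"
    and "(\<integral>y. 2 * (exp (- (w * of_real y)) * complex_of_real (exp (- exp (- y)))) \<partial>lborel) = 2 * Gamma w"
    by simp_all
  then show "(\<integral>y. exp (- (w * of_real y)) * of_real (exp (- exp (- y))) \<partial>lborel) = Gamma w"
    by simp
  show "integrable lborel (\<lambda>y. exp (- (w * of_real y)) * of_real (exp (- exp (- y))))"
    using integrable_mult_right[OF int2, of "1 / 2"] by simp
qed

text \<open>The preceding integral at p y - k: p allows for a power of the radius, and k for the
  logarithm of a scale.\<close>

lemma Gamma_integral_exp_affine: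
  fixes w :: complex and k p :: real
  assumes w: "Re w > 0" and p: "p > 0"
  shows "integrable lborel (\<lambda>y. exp (- (w * of_real y)) * of_real (exp (- exp (k - p * y))))"
    and "(\<integral>y. exp (- (w * of_real y)) * of_real (exp (- exp (k - p * y))) \<partial>lborel) =
      Gamma (w / p) / p * exp (- (w * k / p))"
proof -
  define f where "f y = exp (- (w / p * of_real y)) * complex_of_real (exp (- exp (- y)))" for y
  have [measurable]: "f \<in> borel_measurable borel" unfolding f_def by measurable
  have f: "integrable lborel f" "integral\<^sup>L lborel f = Gamma (w / p)"
    unfolding f_def[abs_def] using Gamma_integral_exp[of "w / p"] w p by auto
  have aff: "integrable lborel (\<lambda>y. f (- k + p *\<^sub>R y))" "(\<integral>y. f (- k + p *\<^sub>R y) \<partial>lborel) = Gamma (w / p) / p"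
    using lborel_integral_affine[of p f "- k"] f p by (auto simp: scaleR_conv_of_real)
  have eq: "exp (- (w * of_real y)) * complex_of_real (exp (- exp (k - p * y))) = exp (- (w * k / p)) * f (- k + p *\<^sub>R y)" for y
  proof -
    have "- (w / p * of_real (- k + p * y)) = w * k / p - w * of_real y"
      using p by (simp add: field_simps)
    then show ?thesis by (simp add: f_def exp_diff exp_minus field_simps)
  qed
  show "integrable lborel (\<lambda>y. exp (- (w * of_real y)) * of_real (exp (- exp (k - p * y))))"
    unfolding eq using aff by simp
  show "(\<integral>y. exp (- (w * of_real y)) * of_real (exp (- exp (k - p * y))) \<partial>lborel) =
      Gamma (w / p) / p * exp (- (w * k / p))"
    unfolding eq using aff by simp
qed

section \<open>Bounds for the Gamma function on vertical lines\<close>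

text \<open>The modulus of Euler's integrand depends on Re z only.\<close>

lemma norm_Gamma_le:
  assumes "Re z > 0"
  shows "norm (Gamma z) \<le> Gamma (Re z)"
proof -
  have "norm (Gamma z) \<le> (\<integral>y. norm (exp (- (z * of_real y)) * complex_of_real (exp (- exp (- y)))) \<partial>lborel)"
    unfolding Gamma_integral_exp(2)[OF assms, symmetric] by (rule integral_norm_bound)
  also have "\<dots> = Re (\<integral>y. exp (- (complex_of_real (Re z) * of_real y)) * of_real (exp (- exp (- y))) \<partial>lborel)"
  proof -
    have "exp (- (complex_of_real (Re z) * of_real y)) * of_real (exp (- exp (- y))) =
        of_real (norm (exp (- (z * of_real y)) * complex_of_real (exp (- exp (- y)))))" for y
      by (simp only: norm_mult norm_exp_eq_Re norm_of_real of_real_mult[symmetric] of_real_minus[symmetric] exp_of_real) simp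
    then show ?thesis by (simp only: integral_complex_of_real Re_complex_of_real)
  qed
  also have "\<dots> = Gamma (Re z)"
    using assms by (subst Gamma_integral_exp(2)) (auto simp: Gamma_complex_of_real)
  finally show ?thesis .
qed

text \<open>Two uses of the functional equation give \<Gamma>(z) = \<Gamma>(z+2) / (z (z+1)). The
  numerator is bounded on a vertical line and the denominator grows quadratically, which is enough
  for integrability. The minimum with 1 makes |z| comparable to sqrt (1 + (Im z)^2).\<close>

lemma norm_Gamma_le_quadratic_decay:
  assumes z: "Re z > 0"
  shows "norm (Gamma z) \<le> Gamma (Re z + 2) / min 1 (Re z) * inverse (1 + (Im z)\<^sup>2)"
proof -
  have nz: "z \<noteq> 0" "z + 1 \<noteq> 0"
    using z by (auto simp: complex_eq_iff)
  let ?q = "1 + (Im z)\<^sup>2"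
  have "z \<notin> \<int>\<^sub>\<le>\<^sub>0" "z + 1 \<notin> \<int>\<^sub>\<le>\<^sub>0"
    using z by (auto elim!: nonpos_Ints_cases simp: complex_eq_iff)
  then have "Gamma (z + 2) = (z + 1) * (z * Gamma z)"
    using Gamma_plus1[of z] Gamma_plus1[of "z + 1"] nz by (simp add: add.assoc)
  then have G: "norm (Gamma z) = norm (Gamma (z + 2)) / (norm z * norm (z + 1))"
    using nz by (simp add: norm_mult)
  have m: "0 < min 1 (Re z)" using z by simp
  have q: "sqrt ?q * sqrt ?q = ?q" by simp
  have "min 1 (Re z) * sqrt ?q \<le> norm z"
  proof -
    have "(min 1 (Re z))\<^sup>2 * ?q \<le> (Re z)\<^sup>2 + (Im z)\<^sup>2"
      unfolding distrib_left using m z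
      by (intro add_mono) (auto intro!: power_mono mult_left_le_one_le power_le_one)
    then have "sqrt ((min 1 (Re z))\<^sup>2 * ?q) \<le> norm z"
      by (simp add: cmod_def)
    then show ?thesis using m by (simp add: real_sqrt_mult)
  qed
  moreover have "sqrt ?q \<le> norm (z + 1)"
    using z by (auto simp: cmod_def power2_eq_square algebra_simps)
  ultimately have "(min 1 (Re z) * sqrt ?q) * sqrt ?q \<le> norm z * norm (z + 1)"
    using m by (intro mult_mono) auto
  then have den: "min 1 (Re z) * ?q \<le> norm z * norm (z + 1)"
    by (simp only: mult.assoc q)
  have "norm (Gamma (z + 2)) \<le> Gamma (Re z + 2)"
    using norm_Gamma_le[of "z + 2"] z by simp
  then have "norm (Gamma z) \<le> Gamma (Re z + 2) / (min 1 (Re z) * ?q)"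
    unfolding G using den m z
    by (intro frac_le) (auto intro!: mult_pos_pos add_pos_nonneg)
  then show ?thesis by (simp add: field_simps)
qed

text \<open>
  Both sides are limits of finite products, in which the inequality holds factor by factor:
  \<open>(x + a k) / \<bar>w + a k\<bar> \<le> (x + k) / \<bar>w + k\<bar>\<close> with \<open>x = Re w\<close>.
\<close>
lemma norm_Gamma_ratio_le:
  fixes w :: complex
  assumes w: "Re w > 0" and a: "0 < a" "a \<le> 1"
  shows "norm (Gamma (w / of_real a)) * Gamma (Re w) \<le> norm (Gamma w) * Gamma (Re w / a)"
proof -
  let ?x = "complex_of_real (Re w)"
  have nz: "norm (pochhammer z n) > 0" if "Re z > 0" for z :: complex and n
  proof -
    have "z \<noteq> - of_nat k" for k
    proof
      assume "z = - of_nat k"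
      then have "Re z = - real k" by simp
      with that show False by simp
    qed
    then show ?thesis by (auto simp: pochhammer_eq_0_iff)
  qed
  have norm_series: "norm (Gamma_series z n) = fact n * real n powr Re z / norm (pochhammer z (n + 1))"
    if "n > 0" for z :: complex and n
    using that by (simp add: Gamma_series_def norm_divide norm_mult powr_def)
  have le: "norm (Gamma_series (w / a) n) * norm (Gamma_series ?x n)
      \<le> norm (Gamma_series w n) * norm (Gamma_series (?x / a) n)" if n: "n > 0" for n
  proof -
    have "norm (w + of_nat k) * norm (?x / a + of_nat k) \<le> norm (?x + of_nat k) * norm (w / a + of_nat k)" for k
    proof -
      let ?k = "real k"
      \<comment> \<open>After squaring and cancelling (x + k)^2 (x + a k)^2, what remains is the
        comparison of (Im w)^2 (x + a k)^2 with (Im w)^2 (x + k)^2.\<close>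
      have "(norm (w + of_nat k) * (Re w + a * ?k))\<^sup>2 \<le> ((Re w + ?k) * norm (w + a * of_nat k))\<^sup>2"
      proof -
        have "(Im w)\<^sup>2 * (Re w + a * ?k)\<^sup>2 \<le> (Im w)\<^sup>2 * (Re w + ?k)\<^sup>2"
          using w a by (intro mult_left_mono power_mono) (auto intro: mult_left_le_one_le)
        then show ?thesis
          unfolding power_mult_distrib cmod_power2 by (simp add: algebra_simps)
      qed
      then have n1: "norm (w + of_nat k) * (Re w + a * ?k) \<le> (Re w + ?k) * norm (w + a * of_nat k)"
        using w by (rule_tac power2_le_imp_le) auto
      have n2: "norm (?x / a + of_nat k) = (Re w + a * ?k) / a"
      proof -
        have "?x / a + of_nat k = of_real ((Re w + a * ?k) / a)"
          using a by (simp add: field_simps)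
        then show ?thesis using w a by (simp only: norm_of_real) simp
      qed
      have n3: "norm (w / a + of_nat k) = norm (w + a * of_nat k) / a"
      proof -
        have "w / a + of_nat k = (w + a * of_nat k) / a"
          using a by (simp add: field_simps)
        then show ?thesis using a by (simp add: norm_divide)
      qed
      have n4: "norm (?x + of_nat k) = Re w + ?k"
      proof -
        have "?x + of_nat k = of_real (Re w + ?k)" by simp
        then show ?thesis using w by (simp only: norm_of_real)
      qed
      show ?thesis
        unfolding n2 n3 n4 times_divide_eq_right using n1 a by (intro divide_right_mono) auto
    qed
    then have "(\<Prod>k<n+1. norm (w + of_nat k) * norm (?x / a + of_nat k)) \<le>
        (\<Prod>k<n+1. norm (?x + of_nat k) * norm (w / a + of_nat k))"
      by (intro prod_mono) auto
    then have *: "norm (pochhammer w (n + 1)) * norm (pochhammer (?x / a) (n + 1)) \<le>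
        norm (pochhammer ?x (n + 1)) * norm (pochhammer (w / a) (n + 1))"
      by (simp only: pochhammer_prod prod.distrib prod_norm atLeast0LessThan)
    have pos: "norm (pochhammer w (n + 1)) > 0" "norm (pochhammer (?x / a) (n + 1)) > 0"
      "norm (pochhammer ?x (n + 1)) > 0" "norm (pochhammer (w / a) (n + 1)) > 0"
      by (rule nz, use w a in simp)+
    \<comment> \<open>The numerators n! n^(Re z) of the approximants agree on both sides after
      commuting, so only the Pochhammer denominators matter.\<close>
    have aux: "A / p * (B / q) \<le> B / r * (A / s)"
      if "0 \<le> A" "0 \<le> B" "0 < r" "0 < s" "r * s \<le> q * p" for A B p q r s :: real
      unfolding times_divide_times_eq mult.commute[of B A] mult.commute[of p q]
      using that by (intro divide_left_mono) (auto intro: order_less_le_trans[OF mult_pos_pos])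
    have Re: "Re (w / a) = Re w / a" "Re ?x = Re w" "Re (?x / a) = Re w / a"
      by simp_all
    show ?thesis
      unfolding norm_series[OF n] Re by (rule aux[OF _ _ pos(1,2) *]) simp_all
  qed
  have "norm (Gamma (w / a)) * norm (Gamma ?x) \<le> norm (Gamma w) * norm (Gamma (?x / a))"
  proof (rule tendsto_le)
    show "((\<lambda>n. norm (Gamma_series (w / a) n) * norm (Gamma_series ?x n)) \<longlongrightarrow> norm (Gamma (w / a)) * norm (Gamma ?x)) sequentially"
      by (intro tendsto_intros)
    show "((\<lambda>n. norm (Gamma_series w n) * norm (Gamma_series (?x / a) n)) \<longlongrightarrow> norm (Gamma w) * norm (Gamma (?x / a))) sequentially"
      by (intro tendsto_intros)
    show "\<forall>\<^sub>F n in sequentially. norm (Gamma_series (w / a) n) * norm (Gamma_series ?x n) \<le>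
        norm (Gamma_series w n) * norm (Gamma_series (?x / a) n)"
      using eventually_gt_at_top[of 0] by eventually_elim (rule le)
  qed auto
  moreover have "norm (Gamma (complex_of_real r)) = Gamma r" if "r > 0" for r
    using that by (simp add: Gamma_complex_of_real)
  from this[of "Re w"] this[of "Re w / a"] have "norm (Gamma ?x) = Gamma (Re w)" "norm (Gamma (?x / a)) = Gamma (Re w / a)"
    using w a by auto
  ultimately show ?thesis by simp
qed

section \<open>Negative moments\<close>

text \<open>With u = exp (- p y) this is the Mellin transform of the Laplace transform of exp
  \<kappa>. Fubini puts the y-integral inside, where it is a Gamma integral; \<open>int\<close> is
  the absolute integrability that this exchange requires.\<close>

lemma mellin_exp:
  fixes P :: "'b measure" and \<kappa> :: "'b \<Rightarrow> real" and w :: complex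
  assumes "sigma_finite_measure P" and [measurable]: "\<kappa> \<in> borel_measurable P"
    and p: "p > 0" and w: "Re w > 0"
    and int: "integrable P (\<lambda>x. exp (- (Re w * \<kappa> x / p)))"
  shows "(CLINT y|lborel. exp (- (w * of_real y)) * of_real (\<integral>x. exp (- exp (\<kappa> x - p * y)) \<partial>P)) =
    Gamma (w / p) / p * (CLINT x|P. exp (- (w * \<kappa> x / p)))"
proof -
  interpret sigma_finite_measure P by fact
  interpret pair_sigma_finite P "lborel :: real measure" ..
  define h where "h x y = exp (- (w * of_real y)) * complex_of_real (exp (- exp (\<kappa> x - p * y)))" for x y
  have [measurable]: "case_prod h \<in> borel_measurable (P \<Otimes>\<^sub>M lborel)"
    unfolding h_def by measurable
  have h: "integrable lborel (h x)" "(\<integral>y. h x y \<partial>lborel) = Gamma (w / p) / p * exp (- (w * \<kappa> x / p))" for x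
    unfolding h_def[abs_def] by (fact Gamma_integral_exp_affine[OF w p])+
  have norm_h: "(\<integral>y. norm (h x y) \<partial>lborel) = Gamma (Re w / p) / p * exp (- (Re w * \<kappa> x / p))" for x
  proof -
    have "exp (- (complex_of_real (Re w) * of_real y)) * of_real (exp (- exp (\<kappa> x - p * y))) = of_real (norm (h x y))" for y
      by (simp only: h_def norm_mult norm_exp_eq_Re norm_of_real of_real_mult[symmetric] of_real_minus[symmetric] exp_of_real) simp
    then have "complex_of_real (\<integral>y. norm (h x y) \<partial>lborel) =
        Gamma (complex_of_real (Re w) / p) / p * exp (- (complex_of_real (Re w) * \<kappa> x / p))"
      using Gamma_integral_exp_affine(2)[of "complex_of_real (Re w)" p "\<kappa> x"] w p by simp
    also have "\<dots> = of_real (Gamma (Re w / p) / p * exp (- (Re w * \<kappa> x / p)))"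
      by (simp add: Gamma_complex_of_real[symmetric] exp_of_real[symmetric])
    finally show ?thesis by (simp only: of_real_eq_iff)
  qed
  have hint: "integrable (P \<Otimes>\<^sub>M lborel) (case_prod h)"
    by (rule Fubini_integrable) (use int h in \<open>simp_all add: norm_h\<close>)
  have "(CLINT y|lborel. exp (- (w * of_real y)) * of_real (\<integral>x. exp (- exp (\<kappa> x - p * y)) \<partial>P)) =
      (CLINT y|lborel. CLINT x|P. h x y)"
    by (simp add: h_def)
  also have "\<dots> = (CLINT x|P. CLINT y|lborel. h x y)"
    using Fubini_integral[OF hint] by simp
  also have "\<dots> = Gamma (w / p) / p * (CLINT x|P. exp (- (w * \<kappa> x / p)))"
    by (simp add: h)
  finally show ?thesis .
qed

text \<open>The factor d times the volume of the unit ball is the area of the unit sphere, which is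
  the constant in the radial formula.\<close>

lemma unit_ball_vol_eq:
  assumes "d > 0"
  shows "d * unit_ball_vol d * Gamma (d / 2) = 2 * pi powr (d / 2)"
proof -
  have G: "Gamma (d / 2 + 1) = d / 2 * Gamma (d / 2)"
    using assms by (intro Gamma_plus1) (auto simp: nonpos_Ints_def)
  have "Gamma (d / 2) \<noteq> 0" using Gamma_real_pos[of "d / 2"] assms by linarith
  then show ?thesis unfolding unit_ball_vol_def G using assms by (simp add: field_simps)
qed

lemma exp_2_ln:
  fixes r :: real
  assumes "r > 0"
  shows "exp (2 * ln r - ln 2) = r\<^sup>2 / 2"
proof -
  have "2 * ln r - ln 2 = (ln r + ln r) - ln 2" by simp
  then show ?thesis using assms by (simp only: exp_diff exp_add exp_ln power2_eq_square)
qed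

text \<open>The exponential encodes |x|^(-v) off the origin, and Re v < d makes it integrable there.
  In the coordinate - ln |x| the integral is a Gamma integral with p = 2.\<close>

lemma std_gauss_moment:
  fixes v :: complex
  assumes v: "Re v < DIM('a::euclidean_space)"
  shows "integrable lborel (\<lambda>x::'a. std_gauss x *\<^sub>R exp (v * of_real (- ln (norm x))))"
    and "(CLINT x|(lborel :: 'a measure). std_gauss x *\<^sub>R exp (v * of_real (- ln (norm x)))) =
      Gamma ((DIM('a) - v) / 2) / of_real (Gamma (real DIM('a) / 2)) * exp (- (v / 2 * of_real (ln 2)))"
proof -
  let ?d = "real DIM('a)"
  let ?c = "?d * unit_ball_vol ?d"
  let ?g = "(2 * pi) powr (- ?d / 2)"
  define f where "f y = complex_of_real (?g * exp (- exp (- ln 2 - 2 * y))) * exp (v * of_real y)" for y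
  have [measurable]: "f \<in> borel_measurable borel" unfolding f_def by measurable
  have eq: "AE x::'a in lborel. std_gauss x *\<^sub>R exp (v * of_real (- ln (norm x))) = f (- ln (norm x))"
    using AE_lborel_singleton[of 0]
  proof eventually_elim
    case (elim x)
    have "exp (- ln 2 - 2 * - ln (norm x)) = (norm x)\<^sup>2 / 2"
      using exp_2_ln[of "norm x"] elim by (simp add: algebra_simps)
    then show ?case by (simp add: f_def std_gauss_def scaleR_conv_of_real)
  qed
  define k where "k y = exp (- ((?d - v) * of_real y)) * complex_of_real (exp (- exp (- ln 2 - 2 * y)))" for y
  have k: "integrable lborel k"
    "integral\<^sup>L lborel k = Gamma ((?d - v) / 2) / 2 * exp ((?d - v) * of_real (ln 2) / 2)"
    using Gamma_integral_exp_affine[of "?d - v" 2 "- ln 2"] v by (auto simp: k_def[abs_def] Ln_of_real)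
  have fk: "(?c * exp (- (?d * y))) *\<^sub>R f y = complex_of_real (?c * ?g) * k y" for y
  proof -
    have "- ((?d - v) * of_real y) = of_real (- (?d * y)) + v * of_real y"
      by (simp add: algebra_simps)
    then have "exp (- ((?d - v) * of_real y)) = of_real (exp (- (?d * y))) * exp (v * of_real y)"
      by (simp only: exp_add exp_of_real)
    then show ?thesis by (simp add: f_def k_def scaleR_conv_of_real)
  qed
  have "integrable lborel (\<lambda>x::'a. f (- ln (norm x)))"
    by (subst lborel_integral_neg_ln_norm) (auto simp: fk k)
  then show "integrable lborel (\<lambda>x::'a. std_gauss x *\<^sub>R exp (v * of_real (- ln (norm x))))"
    by (subst integrable_cong_AE[OF _ _ eq]) auto
  have "(CLINT x|(lborel :: 'a measure). std_gauss x *\<^sub>R exp (v * of_real (- ln (norm x)))) =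
      (CLINT x|(lborel :: 'a measure). f (- ln (norm x)))"
    by (rule integral_cong_AE[OF _ _ eq]) auto
  also have "\<dots> = of_real (?c * ?g) * (Gamma ((?d - v) / 2) / 2 * exp ((?d - v) * of_real (ln 2) / 2))"
    by (subst lborel_integral_neg_ln_norm) (auto simp: fk k)
  also have "exp ((?d - v) * of_real (ln 2) / 2) = of_real (2 powr (?d / 2)) * exp (- (v / 2 * of_real (ln 2)))"
    by (simp add: powr_def exp_of_real[symmetric] exp_add[symmetric] Ln_of_real field_simps del: exp_of_real)
  also have "of_real (?c * ?g) * (Gamma ((?d - v) / 2) / 2 * (of_real (2 powr (?d / 2)) * exp (- (v / 2 * of_real (ln 2))))) =
      of_real (?c * ?g * 2 powr (?d / 2) / 2) * (Gamma ((?d - v) / 2) * exp (- (v / 2 * of_real (ln 2))))"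
    by simp
  also have "?c * ?g * 2 powr (?d / 2) / 2 = 1 / Gamma (?d / 2)"
  proof -
    have "?c = 2 * pi powr (?d / 2) / Gamma (?d / 2)"
      using unit_ball_vol_eq[of ?d] by (simp add: field_simps less_imp_neq[OF Gamma_real_pos, symmetric])
    moreover have "?g * 2 powr (?d / 2) * pi powr (?d / 2) = 1"
      by (simp add: powr_mult powr_minus field_simps)
    ultimately show ?thesis by (simp add: field_simps)
  qed
  finally show "(CLINT x|(lborel :: 'a measure). std_gauss x *\<^sub>R exp (v * of_real (- ln (norm x)))) =
      Gamma ((DIM('a) - v) / 2) / of_real (Gamma (real DIM('a) / 2)) * exp (- (v / 2 * of_real (ln 2)))"
    by (simp add: Gamma_complex_of_real[symmetric])
qed

section \<open>Moments of the stable law\<close>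

text \<open>From here on stability enters only through the characteristic function; spherical
  symmetry is assumed separately where the density must be radial.\<close>

locale symmetric_stable = euclidean_finite_measure N for N :: "'a::euclidean_space measure" +
  fixes \<alpha> :: real
  assumes \<alpha>: "0 < \<alpha>" "\<alpha> \<le> 2"
    and char_N: "char_fun N \<xi> = of_real (exp (- (norm \<xi> powr \<alpha>)))"
begin

text \<open>In the coordinate - ln |\<xi>| the polar weight turns the integral into a Gamma integral
  with p = \<alpha>.\<close>

lemma integrable_char: "integrable lborel (char_fun N)"
proof -
  define f where "f y = complex_of_real (exp (- exp (- (\<alpha> * y))))" for y
  have [measurable]: "f \<in> borel_measurable borel" unfolding f_def by measurable
  have eq: "AE x::'a in lborel. char_fun N x = f (- ln (norm x))"
    using AE_lborel_singleton[of 0]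
    by eventually_elim (simp add: char_N f_def powr_def)
  define k where "k y = exp (- (of_real (real DIM('a)) * of_real y)) * complex_of_real (exp (- exp (0 - \<alpha> * y)))" for y
  have k: "integrable lborel k"
    unfolding k_def[abs_def] using \<alpha> by (intro Gamma_integral_exp_affine(1)) auto
  have fk: "(real DIM('a) * unit_ball_vol (real DIM('a)) * exp (- (real DIM('a) * y))) *\<^sub>R f y =
      complex_of_real (real DIM('a) * unit_ball_vol (real DIM('a))) * k y" for y
    by (simp add: f_def k_def scaleR_conv_of_real exp_of_real[symmetric] del: exp_of_real)
  have "integrable lborel (\<lambda>x::'a. f (- ln (norm x)))"
    by (subst lborel_integral_neg_ln_norm) (auto simp: fk k)
  then show ?thesis
    by (subst integrable_cong_AE[OF _ _ eq]) auto
qed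

lemmas density_N = fourier_inversion[OF integrable_char]

lemma borel_measurable_inv_fourier_N [measurable]: "inv_fourier N \<in> borel_measurable borel"
  by (rule borel_measurable_inv_fourier[OF integrable_char])

lemma AE_N:
  assumes "AE x in lborel. Q x"
  shows "AE x in N. Q x"
  by (subst density_N, subst AE_density) (use assms in \<open>auto elim: eventually_mono\<close>)

lemma integral_N:
  fixes f :: "'a \<Rightarrow> 'b::{banach, second_countable_topology}"
  assumes [measurable]: "f \<in> borel_measurable borel"
  shows "integral\<^sup>L N f = (\<integral>x. Re (inv_fourier N x) *\<^sub>R f x \<partial>lborel)"
    and "integrable N f \<longleftrightarrow> integrable lborel (\<lambda>x. Re (inv_fourier N x) *\<^sub>R f x)"
proof -
  have nn: "AE x in lborel. 0 \<le> Re (inv_fourier N x)"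
    using inv_fourier_nonneg[OF integrable_char] by simp
  show "integral\<^sup>L N f = (\<integral>x. Re (inv_fourier N x) *\<^sub>R f x \<partial>lborel)"
    by (subst density_N, subst integral_density) (use nn in auto)
  show "integrable N f \<longleftrightarrow> integrable lborel (\<lambda>x. Re (inv_fourier N x) *\<^sub>R f x)"
    by (subst density_N, subst integrable_density) (use nn in auto)
qed

text \<open>On the unit ball the density is bounded, so the Gaussian moment dominates; outside it
  |x|^(-a) is at most 1.\<close>

lemma integrable_neg_moment:
  fixes a :: real
  assumes a: "0 < a" "a < DIM('a)"
  shows "integrable N (\<lambda>x. exp (a * - ln (norm x)))"
proof -
  define C where "C = (2 * pi) powr (- real DIM('a)) * (\<integral>\<xi>. norm (char_fun N \<xi>) \<partial>lborel)"
  \<comment> \<open>The minimum of the Gaussian density on the closed unit ball.\<close>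
  define c where "c = (2 * pi) powr (- real DIM('a) / 2) * exp (- 1 / 2)"
  have c: "c > 0" by (simp add: c_def)
  have \<rho>: "0 \<le> Re (inv_fourier N x)" "Re (inv_fourier N x) \<le> C" for x
    using inv_fourier_nonneg[OF integrable_char] inv_fourier_le[OF integrable_char] by (auto simp: C_def)
  have C: "C \<ge> 0" using \<rho>[of 0] by linarith
  have "integrable lborel (\<lambda>x::'a. norm (std_gauss x *\<^sub>R exp (complex_of_real a * of_real (- ln (norm x)))))"
    using a by (intro integrable_norm std_gauss_moment) auto
  then have int: "integrable lborel (\<lambda>x::'a. std_gauss x * exp (a * - ln (norm x)))"
    by (simp add: std_gauss_pos less_imp_le norm_exp_eq_Re)
  have "integrable N (\<lambda>_. 1::real)" by simp
  then have int1: "integrable lborel (\<lambda>x. Re (inv_fourier N x))"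
    by (subst (asm) integral_N) auto
  have "integrable lborel (\<lambda>x. Re (inv_fourier N x) *\<^sub>R exp (a * - ln (norm x)))"
  proof (rule Bochner_Integration.integrable_bound)
    show "integrable lborel (\<lambda>x. Re (inv_fourier N x) + C / c * (std_gauss x * exp (a * - ln (norm x))))"
      using int int1 by (intro Bochner_Integration.integrable_add integrable_mult_right)
    show "AE x in lborel. norm (Re (inv_fourier N x) *\<^sub>R exp (a * - ln (norm x)))
      \<le> norm (Re (inv_fourier N x) + C / c * (std_gauss x * exp (a * - ln (norm x))))"
    proof (rule AE_I2)
      fix x :: 'a
      let ?e = "exp (a * - ln (norm x))"
      have nn: "0 \<le> C / c * (std_gauss x * ?e)"
        using C c std_gauss_pos[of x] by simp
      have "Re (inv_fourier N x) * ?e \<le> Re (inv_fourier N x) + C / c * (std_gauss x * ?e)"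
      proof (cases "norm x \<le> 1")
        case True
        have "c \<le> std_gauss x"
          unfolding c_def std_gauss_def using True by (intro mult_left_mono) (auto simp: power_le_one)
        then have "C * ?e \<le> C * (std_gauss x / c) * ?e"
          using C c by (intro mult_right_mono) (auto simp: mult_left_mono pos_le_divide_eq)
        moreover have "Re (inv_fourier N x) * ?e \<le> C * ?e"
          using \<rho>[of x] by (intro mult_right_mono) auto
        moreover have "C * (std_gauss x / c) * ?e = C / c * (std_gauss x * ?e)" by simp
        ultimately show ?thesis using \<rho>(1)[of x] by linarith
      next
        case False
        then have "?e \<le> 1" using a by simp
        then have "Re (inv_fourier N x) * ?e \<le> Re (inv_fourier N x)"
          using \<rho>[of x] by (intro mult_left_le) auto
        then show ?thesis using nn by linarith
      qed
      then show "norm (Re (inv_fourier N x) *\<^sub>R ?e) \<le> norm (Re (inv_fourier N x) + C / c * (std_gauss x * ?e))"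
        using \<rho>[of x] nn by simp
    qed
  qed measurable
  then show ?thesis by (subst integral_N) auto
qed

text \<open>
  \<open>exp (- u \<bar>x\<bar>\<^sup>2)\<close> is the characteristic function of a Gaussian vector, so its \<open>N\<close>-mean is a
  Gaussian mean of the characteristic function of \<open>N\<close>; here \<open>u = K\<^sup>2 / 2\<close>.
\<close>
lemma laplace_norm_square:
  assumes K: "K > 0"
  shows "(\<integral>x. exp (- ((K * norm x)\<^sup>2 / 2)) \<partial>N) = (\<integral>\<eta>. std_gauss \<eta> * exp (- ((K * norm \<eta>) powr \<alpha>)) \<partial>(lborel :: 'a measure))"
proof -
  let ?c = "(2 * pi) powr (- real DIM('a) / 2)"
  \<comment> \<open>The smoothed density at the origin is evaluated on the Fourier side here and
    from its definition at the end.\<close>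
  have "complex_of_real (gauss_smooth N K 0) = ?c * (CLINT \<xi>|lborel. char_fun N \<xi> * std_gauss ((1 / K) *\<^sub>R \<xi>))"
    using gauss_smooth_fourier[OF K, of 0] by simp
  also have "(CLINT \<xi>|lborel. char_fun N \<xi> * std_gauss ((1 / K) *\<^sub>R \<xi>)) =
      \<bar>K\<bar> ^ DIM('a) *\<^sub>R (CLINT \<eta>|lborel. char_fun N (0 + K *\<^sub>R \<eta>) * std_gauss ((1 / K) *\<^sub>R (0 + K *\<^sub>R (\<eta>::'a))))"
    using K by (intro lborel_integral_affine) auto
  also have "(CLINT \<eta>|lborel. char_fun N (0 + K *\<^sub>R \<eta>) * std_gauss ((1 / K) *\<^sub>R (0 + K *\<^sub>R (\<eta>::'a)))) =
      of_real (\<integral>\<eta>. std_gauss \<eta> * exp (- ((K * norm \<eta>) powr \<alpha>)) \<partial>(lborel :: 'a measure))"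
    unfolding integral_complex_of_real[symmetric]
    using K by (intro Bochner_Integration.integral_cong) (auto simp: char_N mult.commute)
  finally have "gauss_smooth N K 0 = ?c * (K ^ DIM('a) * (\<integral>\<eta>. std_gauss \<eta> * exp (- ((K * norm \<eta>) powr \<alpha>)) \<partial>(lborel :: 'a measure)))"
    using K by (simp only: scaleR_conv_of_real of_real_mult[symmetric] of_real_eq_iff abs_of_pos)
  moreover have "gauss_smooth N K 0 = K ^ DIM('a) * (?c * (\<integral>x. exp (- ((K * norm x)\<^sup>2 / 2)) \<partial>N))"
    using K by (simp add: gauss_smooth_def std_gauss_def)
  ultimately show ?thesis using K by simp
qed

text \<open>Both sides of \<open>laplace_norm_square\<close> are Mellin transformed by
  \<open>mellin_exp\<close>: the left one over N with p = 1, the right one over the Gaussian law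
  with p = \<alpha>/2. This yields \<Gamma>(v/2) and \<Gamma>(v/\<alpha>), and the Gaussian moment
  is known.\<close>

lemma neg_moment:
  fixes v :: complex
  assumes v: "0 < Re v" "Re v < DIM('a)"
  shows "(CLINT x|N. exp (v * of_real (- ln (norm x)))) =
    2 / \<alpha> * (Gamma (v / \<alpha>) / Gamma (v / 2)) * exp (- (v * of_real (ln 2))) * Gamma ((DIM('a) - v) / 2) / of_real (Gamma (real DIM('a) / 2))"
proof -
  define G where "G = density lborel (\<lambda>x::'a. ennreal (std_gauss x))"
  have [measurable_cong]: "sets G = sets borel" by (simp add: G_def)
  have G: "integral\<^sup>L G f = (\<integral>x. std_gauss x *\<^sub>R f x \<partial>lborel)"
      "integrable G f \<longleftrightarrow> integrable lborel (\<lambda>x. std_gauss x *\<^sub>R f x)"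
    if [measurable]: "f \<in> borel_measurable borel" for f :: "'a \<Rightarrow> 'b::{banach, second_countable_topology}"
    unfolding G_def by (subst integral_density integrable_density; simp add: std_gauss_pos less_imp_le)+
  have "prob_space G"
  proof
    have "emeasure G (space G) = ennreal (integral\<^sup>L lborel (std_gauss :: 'a \<Rightarrow> real))"
      unfolding G_def
      by (subst emeasure_density) (auto simp: integrable_std_gauss std_gauss_pos less_imp_le intro!: nn_integral_eq_integral)
    then show "emeasure G (space G) = 1" by (simp add: integral_std_gauss)
  qed
  then interpret G: prob_space G .
  \<comment> \<open>With K = sqrt 2 * exp (- y/2), so that K^2 / 2 = exp (- y), the exponents are
    arranged to give exp (\<kappa>1 - y) = (K |x|)^2 / 2 and exp (\<kappa>2 - \<alpha> y / 2) = (K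
    |x|)^\<alpha>.\<close>
  let ?\<kappa>1 = "\<lambda>x::'a. 2 * ln (norm x)"
  let ?\<kappa>2 = "\<lambda>x::'a. \<alpha> * ln (norm x) + \<alpha> / 2 * ln 2"
  have L: "(\<integral>x. exp (- exp (?\<kappa>1 x - 1 * y)) \<partial>N) = (\<integral>x. exp (- exp (?\<kappa>2 x - \<alpha> / 2 * y)) \<partial>G)" for y
  proof -
    define K where "K = exp (ln 2 / 2 - y / 2)"
    have K: "K > 0" by (simp add: K_def)
    have "AE x::'a in lborel. exp (?\<kappa>1 x - 1 * y) = (K * norm x)\<^sup>2 / 2"
      using AE_lborel_singleton[of 0]
    proof eventually_elim
      case (elim x)
      have "(K * norm x)\<^sup>2 / 2 = exp (2 * ln (K * norm x) - ln 2)"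
        using elim K by (intro exp_2_ln[symmetric]) simp
      also have "ln (K * norm x) = ln 2 / 2 - y / 2 + ln (norm x)"
        using elim by (simp add: ln_mult K_def)
      finally show ?case by simp
    qed
    then have "AE x::'a in lborel. exp (- exp (?\<kappa>1 x - 1 * y)) = exp (- ((K * norm x)\<^sup>2 / 2))"
      by eventually_elim simp
    then have "(\<integral>x. exp (- exp (?\<kappa>1 x - 1 * y)) \<partial>N) = (\<integral>x. exp (- ((K * norm x)\<^sup>2 / 2)) \<partial>N)"
      by (intro integral_cong_AE AE_N) auto
    also have "\<dots> = (\<integral>\<eta>. std_gauss \<eta> * exp (- ((K * norm \<eta>) powr \<alpha>)) \<partial>(lborel :: 'a measure))"
      by (rule laplace_norm_square[OF K])
    also have "\<dots> = (\<integral>x. std_gauss x *\<^sub>R exp (- exp (?\<kappa>2 x - \<alpha> / 2 * y)) \<partial>lborel)"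
    proof (rule integral_cong_AE)
      show "AE x::'a in lborel. std_gauss x * exp (- ((K * norm x) powr \<alpha>)) = std_gauss x *\<^sub>R exp (- exp (?\<kappa>2 x - \<alpha> / 2 * y))"
        using AE_lborel_singleton[of 0]
      proof eventually_elim
        case (elim x)
        have "ln (K * norm x) = ln 2 / 2 - y / 2 + ln (norm x)"
          using elim by (simp add: ln_mult K_def)
        then have "\<alpha> * ln (K * norm x) = ?\<kappa>2 x - \<alpha> / 2 * y"
          by (simp only:) (simp add: algebra_simps)
        then have "(K * norm x) powr \<alpha> = exp (?\<kappa>2 x - \<alpha> / 2 * y)"
          using elim K by (simp add: powr_def)
        then show ?case by simp
      qed
    qed auto
    also have "\<dots> = (\<integral>x. exp (- exp (?\<kappa>2 x - \<alpha> / 2 * y)) \<partial>G)"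
      by (subst G) auto
    finally show ?thesis .
  qed
  \<comment> \<open>Halving v compensates for the square of the norm: exp (- w \<kappa>1) is then
    |x|^(-v).\<close>
  let ?w = "v / 2"
  have "Gamma (?w / of_real 1) / of_real 1 * (CLINT x|N. exp (- (?w * ?\<kappa>1 x / of_real 1))) =
      Gamma (?w / of_real (\<alpha> / 2)) / of_real (\<alpha> / 2) * (CLINT x|G. exp (- (?w * ?\<kappa>2 x / of_real (\<alpha> / 2))))"
  proof (subst (1 2) mellin_exp[symmetric])
    show "integrable N (\<lambda>x. exp (- (Re ?w * ?\<kappa>1 x / 1)))"
      using integrable_neg_moment[OF v] by simp
    have "integrable G (\<lambda>x. exp (- (Re v * ln 2 / 2)) * norm (exp (v * of_real (- ln (norm x)))))"
      using std_gauss_moment(1)[of v] v by (intro integrable_mult_right integrable_norm) (auto simp: G)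
    then show "integrable G (\<lambda>x. exp (- (Re ?w * ?\<kappa>2 x / (\<alpha> / 2))))"
      by (rule back_subst[where P = "integrable G"])
        (use \<alpha> in \<open>auto simp: norm_exp_eq_Re exp_add[symmetric] field_simps fun_eq_iff\<close>)
    show "(CLINT y|lborel. exp (- (?w * of_real y)) * of_real (\<integral>x. exp (- exp (?\<kappa>1 x - 1 * y)) \<partial>N)) =
        (CLINT y|lborel. exp (- (?w * of_real y)) * of_real (\<integral>x. exp (- exp (?\<kappa>2 x - \<alpha> / 2 * y)) \<partial>G))"
      unfolding L ..
  qed (use v \<alpha> in \<open>auto simp: sigma_finite_measure_axioms G.sigma_finite_measure_axioms\<close>)
  also have "(CLINT x|N. exp (- (?w * ?\<kappa>1 x / of_real 1))) = (CLINT x|N. exp (v * of_real (- ln (norm x))))"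
    by (intro Bochner_Integration.integral_cong) auto
  also have "(CLINT x|G. exp (- (?w * ?\<kappa>2 x / of_real (\<alpha> / 2)))) =
      (CLINT x|G. exp (- (v / 2 * of_real (ln 2))) * exp (v * of_real (- ln (norm x))))"
  proof (intro Bochner_Integration.integral_cong refl)
    fix x :: 'a
    have "?\<kappa>2 x / (\<alpha> / 2) = 2 * ln (norm x) + ln 2"
      using \<alpha> by (simp add: field_simps)
    moreover have "- (?w * of_real (?\<kappa>2 x) / of_real (\<alpha> / 2)) = - (?w * of_real (?\<kappa>2 x / (\<alpha> / 2)))"
      by (simp only: of_real_divide times_divide_eq_right)
    ultimately have "- (?w * of_real (?\<kappa>2 x) / of_real (\<alpha> / 2)) = - (v / 2 * of_real (ln 2)) + v * of_real (- ln (norm x))"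
      by (simp only:) (simp add: algebra_simps)
    then show "exp (- (?w * of_real (?\<kappa>2 x) / of_real (\<alpha> / 2))) =
        exp (- (v / 2 * of_real (ln 2))) * exp (v * of_real (- ln (norm x)))"
      by (simp only: exp_add)
  qed
  also have "\<dots> = exp (- (v / 2 * of_real (ln 2))) * (CLINT x|(lborel :: 'a measure). std_gauss x *\<^sub>R exp (v * of_real (- ln (norm x))))"
    by (subst integral_mult_right_zero, subst G) auto
  also have "\<dots> = exp (- (v / 2 * of_real (ln 2))) * (Gamma ((DIM('a) - v) / 2) / of_real (Gamma (real DIM('a) / 2)) * exp (- (v / 2 * of_real (ln 2))))"
    using v by (subst std_gauss_moment(2)) auto
  also have "\<dots> = exp (- (v * of_real (ln 2))) * Gamma ((DIM('a) - v) / 2) / of_real (Gamma (real DIM('a) / 2))"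
    by (simp add: exp_add[symmetric] mult.left_commute[of "exp _"] mult.assoc)
  finally have *: "Gamma ?w * (CLINT x|N. exp (v * of_real (- ln (norm x)))) =
      2 / \<alpha> * Gamma (v / \<alpha>) * (exp (- (v * of_real (ln 2))) * Gamma ((DIM('a) - v) / 2) / of_real (Gamma (real DIM('a) / 2)))"
    by (simp add: mult.commute)
  have "Gamma ?w \<noteq> 0"
    using v by (auto simp: Gamma_eq_zero_iff elim!: nonpos_Ints_cases)
  then have "(CLINT x|N. exp (v * of_real (- ln (norm x)))) =
      (Gamma ?w * (CLINT x|N. exp (v * of_real (- ln (norm x))))) / Gamma ?w" by simp
  then show ?thesis unfolding * by (simp only: times_divide_eq_left times_divide_eq_right divide_divide_eq_left) (simp only: mult_ac)
qed

end

section \<open>Mellin inversion\<close>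

text \<open>The set where f and g differ is open and null, and a nonempty open set is not
  null.\<close>

lemma continuous_AE_eq:
  fixes f g :: "'a::euclidean_space \<Rightarrow> real"
  assumes "continuous_on UNIV f" "continuous_on UNIV g" and ae: "AE x in lborel. f x = g x"
  shows "f x = g x"
proof (rule ccontr)
  assume ne: "f x \<noteq> g x"
  have op: "open {x. f x \<noteq> g x}"
    using assms by (intro open_Collect_neq)
  then have "{x. f x \<noteq> g x} \<in> null_sets lborel"
    using ae by (subst AE_iff_null_sets) auto
  then have "negligible {x. f x \<noteq> g x}"
    by (simp add: negligible_iff_null_sets null_sets_completionI)
  then show False using op ne open_not_negligible by blast
qed

context symmetric_stable
begin

text \<open>The invariance is read off from the smoothed densities, which are averages over the
  invariant measure N, and passes to their limit.\<close>

lemma inv_fourier_orthogonal: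
  assumes sym: "spherically_symmetric N" and U: "orthogonal_transformation U"
  shows "Re (inv_fourier N (U x)) = Re (inv_fourier N x)"
proof -
  have [measurable]: "U \<in> borel_measurable borel"
    using U by (intro borel_measurable_continuous_onI linear_continuous_on)
      (simp add: linear_conv_bounded_linear[symmetric] orthogonal_transformation_linear)
  have "gauss_smooth N K (U x) = gauss_smooth N K x" for K
  proof -
    have "(\<integral>y. std_gauss (K *\<^sub>R (y - U x)) \<partial>N) = (\<integral>y. std_gauss (K *\<^sub>R (y - U x)) \<partial>(distr N borel U))"
      using sym U by (simp add: spherically_symmetric_def)
    also have "\<dots> = (\<integral>y. std_gauss (K *\<^sub>R (U y - U x)) \<partial>N)"
      by (subst integral_distr) auto
    also have "\<dots> = (\<integral>y. std_gauss (K *\<^sub>R (y - x)) \<partial>N)"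
      using U by (simp add: std_gauss_def linear_diff[symmetric] orthogonal_transformation_linear
          orthogonal_transformation_norm)
    finally show ?thesis by (simp add: gauss_smooth_def)
  qed
  then show ?thesis
    using tendsto_gauss_smooth[OF integrable_char, of x] tendsto_gauss_smooth[OF integrable_char, of "U x"]
    by (simp add: LIMSEQ_unique)
qed

context
  fixes \<rho> :: "real \<Rightarrow> real"
  assumes radial: "\<And>x. Re (inv_fourier N x) = \<rho> (norm x)"
begin

lemma continuous_radial: "continuous_on {0..} \<rho>"
proof -
  obtain e :: 'a where e: "norm e = 1" using vector_choose_size[of 1] by auto
  have "continuous_on {0..} (\<lambda>r. Re (inv_fourier N (r *\<^sub>R e)))"
    by (intro continuous_intros continuous_on_compose2[OF continuous_inv_fourier[OF integrable_char]]) auto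
  then show ?thesis
    by (rule continuous_on_eq) (simp add: radial e)
qed

lemma radial_nonneg: "0 \<le> r \<Longrightarrow> 0 \<le> \<rho> r"
  using vector_choose_size[of r, where 'a = 'a] inv_fourier_nonneg[OF integrable_char] by (metis radial)

text \<open>
  The function \<open>f\<close> below is, up to a constant, the density of \<open>- ln \<bar>X\<bar>\<close> tilted by \<open>\<bar>X\<bar>\<close> to the
  power \<open>\<alpha> \<gamma>\<close>.  Its Fourier transform at \<open>- \<alpha> t\<close> is a moment of \<open>\<bar>X\<bar>\<close> of order \<open>\<alpha> (\<gamma> + \<i> t)\<close>, that is,
  the Gamma quotient on the line \<open>Re s = \<gamma>\<close>; the integral over the line is Fourier inversion for \<open>f\<close>.
\<close>
lemma foxH_line_integral:
  fixes \<gamma> y :: real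
  assumes \<gamma>: "- real DIM('a) / \<alpha> < \<gamma>" "\<gamma> < 0"
  defines "h \<equiv> \<lambda>t. foxH_integrand 1 1 [(1, 1)] [(of_real (real DIM('a) / 2), \<alpha> / 2), (1, \<alpha> / 2)]
      (of_real ((exp (- y) / 2) powr \<alpha>)) (Complex \<gamma> t)"
  shows "integrable lborel h"
    and "integral\<^sup>L lborel h = of_real (2 * pi * (pi powr (real DIM('a) / 2) * exp (- (real DIM('a) * y)) * \<rho> (exp (- y))))"
proof -
  let ?d = "real DIM('a)"
  define c where "c = ?d * unit_ball_vol ?d"
  have c: "c > 0" by (simp add: c_def)
  \<comment> \<open>The exponent d of the polar weight plus the tilt \<alpha> \<gamma>. The
    conditions on \<gamma> become \<mu> > 0 and \<alpha> \<gamma> < 0, which are the conditions for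
    the moment to exist.\<close>
  define \<mu> where "\<mu> = ?d + \<alpha> * \<gamma>"
  have \<mu>: "\<mu> > 0" using \<gamma> \<alpha> by (simp add: \<mu>_def field_simps)
  have \<alpha>\<gamma>: "\<alpha> * \<gamma> < 0" using \<gamma> \<alpha> by (simp add: mult_pos_neg)
  define f where "f y = exp (- (\<mu> * y)) * \<rho> (exp (- y))" for y
  have cont_\<rho>: "continuous_on UNIV (\<lambda>y. \<rho> (exp (- y)))"
    by (intro continuous_on_compose2[OF continuous_radial] continuous_intros) auto
  have cont: "continuous_on UNIV f"
    unfolding f_def by (intro continuous_intros cont_\<rho>)
  have [measurable]: "f \<in> borel_measurable borel" "(\<lambda>y. \<rho> (exp (- y))) \<in> borel_measurable borel"
    by (intro borel_measurable_continuous_onI cont cont_\<rho>)+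
  have f0: "0 \<le> f y" for y by (simp add: f_def radial_nonneg)
  \<comment> \<open>Chosen so that v (- \<alpha> t) = - \<alpha> s for s = \<gamma> + i t; its real
    part - \<alpha> \<gamma> lies in the range of \<open>neg_moment\<close>.\<close>
  define v where "v \<tau> = \<i> * of_real \<tau> - of_real (\<alpha> * \<gamma>)" for \<tau>
  have v: "0 < Re (v \<tau>)" "Re (v \<tau>) < ?d" for \<tau>
    using \<mu> \<alpha>\<gamma> by (auto simp: v_def \<mu>_def)
  define f2 where "f2 \<tau> y = \<rho> (exp (- y)) *\<^sub>R exp (v \<tau> * of_real y)" for \<tau> y
  have [measurable]: "f2 \<tau> \<in> borel_measurable borel" for \<tau>
    unfolding f2_def by measurable
  have f2: "(c * exp (- (?d * y))) *\<^sub>R f2 \<tau> y = of_real c * (f y *\<^sub>R iexp (\<tau> * y))" for \<tau> y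
  proof -
    have "of_real (- (?d * y)) + v \<tau> * of_real y = of_real (- (\<mu> * y)) + \<i> * of_real (\<tau> * y)"
      by (simp add: v_def \<mu>_def algebra_simps)
    then have "of_real (exp (- (?d * y))) * exp (v \<tau> * of_real y) = of_real (exp (- (\<mu> * y))) * iexp (\<tau> * y)"
      by (simp only: exp_add[symmetric] exp_of_real[symmetric])
    then show ?thesis
      by (simp add: f2_def f_def scaleR_conv_of_real mult_ac)
  qed
  have AE_f2: "AE x::'a in lborel. Re (inv_fourier N x) *\<^sub>R exp (v \<tau> * of_real (- ln (norm x))) = f2 \<tau> (- ln (norm x))" for \<tau>
    using AE_lborel_singleton[of 0] by eventually_elim (simp add: f2_def radial)
  have moment: "(CLINT x|N. exp (v \<tau> * of_real (- ln (norm x)))) = of_real c * (CLINT y|lborel. f y *\<^sub>R iexp (\<tau> * y))" for \<tau>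
  proof -
    have "(CLINT x|N. exp (v \<tau> * of_real (- ln (norm x)))) =
        (CLINT x|lborel. Re (inv_fourier N x) *\<^sub>R exp (v \<tau> * of_real (- ln (norm x))))"
      by (rule integral_N) measurable
    also have "\<dots> = (CLINT x|(lborel :: 'a measure). f2 \<tau> (- ln (norm x)))"
      by (rule integral_cong_AE[OF _ _ AE_f2]) measurable
    also have "\<dots> = (CLINT y|lborel. (c * exp (- (?d * y))) *\<^sub>R f2 \<tau> y)"
      unfolding c_def by (rule lborel_integral_neg_ln_norm) measurable
    also have "\<dots> = of_real c * (CLINT y|lborel. f y *\<^sub>R iexp (\<tau> * y))"
      unfolding f2 by (rule integral_mult_right_zero)
    finally show ?thesis .
  qed
  have int_f: "integrable lborel f"
  proof -
    have "integrable N (\<lambda>x. exp (v 0 * of_real (- ln (norm x))))"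
    proof (rule Bochner_Integration.integrable_bound[OF integrable_neg_moment[of "- (\<alpha> * \<gamma>)"]])
      show "AE x in N. norm (exp (v 0 * of_real (- ln (norm x)))) \<le> norm (exp (- (\<alpha> * \<gamma>) * - ln (norm x)))"
        by (simp add: norm_exp_eq_Re v_def)
    qed (use \<alpha>\<gamma> \<mu> in \<open>auto simp: \<mu>_def\<close>)
    then have "integrable lborel (\<lambda>x. Re (inv_fourier N x) *\<^sub>R exp (v 0 * of_real (- ln (norm x))))"
      by (subst (asm) integral_N) auto
    then have "integrable lborel (\<lambda>x::'a. f2 0 (- ln (norm x)))"
      by (subst (asm) integrable_cong_AE[OF _ _ AE_f2]) auto
    then have "integrable lborel (\<lambda>y. (c * exp (- (?d * y))) *\<^sub>R f2 0 y)"
      unfolding c_def by (subst (asm) lborel_integral_neg_ln_norm) auto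
    then have "integrable lborel (\<lambda>y. complex_of_real (c * f y))"
      unfolding f2 by (simp add: scaleR_conv_of_real)
    then have "integrable lborel (\<lambda>y. c * f y)"
      by (simp only: complex_of_real_integrable_eq)
    then have "integrable lborel (\<lambda>y. 1 / c * (c * f y))" by (rule integrable_mult_right)
    then show ?thesis using c by simp
  qed
  define F where "F = density lborel (\<lambda>y. ennreal (f y))"
  have "finite_measure F"
  proof (rule finite_measureI)
    have "emeasure F (space F) = ennreal (integral\<^sup>L lborel f)"
      unfolding F_def using int_f f0
      by (subst emeasure_density) (auto intro!: nn_integral_eq_integral)
    then show "emeasure F (space F) \<noteq> \<infinity>" by simp
  qed
  then interpret F: euclidean_finite_measure F
    by (intro euclidean_finite_measure.intro euclidean_finite_measure_axioms.intro) (simp_all add: F_def)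
  have char_F: "char_fun F \<tau> = of_real (1 / c) *
      (2 / \<alpha> * (Gamma (v \<tau> / \<alpha>) / Gamma (v \<tau> / 2)) * exp (- (v \<tau> * of_real (ln 2))) *
       Gamma ((DIM('a) - v \<tau>) / 2) / of_real (Gamma (?d / 2)))" for \<tau>
  proof -
    have "char_fun F \<tau> = (CLINT y|lborel. f y *\<^sub>R iexp (\<tau> * y))"
      unfolding char_fun_def F_def by (subst integral_density) (auto simp: f0)
    also have "\<dots> = of_real (1 / c) * (CLINT x|N. exp (v \<tau> * of_real (- ln (norm x))))"
      using c unfolding moment by simp
    also note neg_moment[OF v]
    finally show ?thesis .
  qed
  \<comment> \<open>The ratio bound with a = \<alpha>/2, at most 1, controls \<Gamma>(v/\<alpha>) /
    \<Gamma>(v/2) uniformly in \<tau>. The factor \<Gamma>((d - v)/2), with imaginary part of size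
    |\<tau>|/2, decays quadratically, and the remaining factors have constant modulus.\<close>
  have int_F: "integrable lborel (char_fun F)"
  proof (rule Bochner_Integration.integrable_bound)
    define x where "x = - (\<alpha> * \<gamma>) / 2"
    have x: "x > 0" "?d / 2 - x > 0" using \<alpha>\<gamma> \<mu> by (auto simp: x_def \<mu>_def)
    define K where "K = 1 / c * (2 / \<alpha>) * (Gamma (x / (\<alpha> / 2)) / Gamma x) * exp (\<alpha> * \<gamma> * ln 2) *
       (Gamma (?d / 2 - x + 2) / min 1 (?d / 2 - x)) / Gamma (?d / 2)"
    show "integrable lborel (\<lambda>\<tau>::real. K * inverse (1 + (0 + (1 / 2) *\<^sub>R \<tau>)\<^sup>2))"
      by (intro integrable_mult_right, subst lborel_integral_affine(2)) (use integrable_inverse_1_plus_square in \<open>auto simp: set_integrable_def\<close>)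
    show "AE \<tau> in lborel. norm (char_fun F \<tau>) \<le> norm (K * inverse (1 + (0 + (1 / 2) *\<^sub>R \<tau>)\<^sup>2))"
    proof (rule AE_I2)
      fix \<tau> :: real
      define w where "w = v \<tau> / 2"
      have Rew: "Re w = x" by (simp add: w_def v_def x_def)
      have Gx: "Gamma x > 0" "Gamma (?d / 2) > 0" using x by auto
      have Gw: "norm (Gamma w) > 0"
        using x Rew by (auto simp: Gamma_eq_zero_iff elim!: nonpos_Ints_cases)
      have "norm (Gamma (w / of_real (\<alpha> / 2))) * Gamma (Re w) \<le> norm (Gamma w) * Gamma (Re w / (\<alpha> / 2))"
        by (rule norm_Gamma_ratio_le) (use x Rew \<alpha> in auto)
      then have 1: "norm (Gamma (v \<tau> / \<alpha>) / Gamma (v \<tau> / 2)) \<le> Gamma (x / (\<alpha> / 2)) / Gamma x"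
        using Gx Gw Rew by (simp add: w_def norm_divide field_simps)
      have u: "(of_nat DIM('a) - v \<tau>) / 2 = of_real (?d / 2) - w"
        "Re (of_real (?d / 2) - w) = ?d / 2 - x" "(Im (of_real (?d / 2) - w))\<^sup>2 = (\<tau> / 2)\<^sup>2"
        using Rew by (simp_all add: w_def v_def diff_divide_distrib power_divide)
      have 2: "norm (Gamma ((of_nat DIM('a) - v \<tau>) / 2)) \<le>
          Gamma (?d / 2 - x + 2) / min 1 (?d / 2 - x) * inverse (1 + (\<tau> / 2)\<^sup>2)"
        using norm_Gamma_le_quadratic_decay[of "of_real (?d / 2) - w"] x(2) unfolding u by blast
      have 3: "norm (exp (- (v \<tau> * of_real (ln 2)))) = exp (\<alpha> * \<gamma> * ln 2)"
        by (simp add: norm_exp_eq_Re v_def)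
      have 4: "norm (complex_of_real (Gamma (?d / 2))) = Gamma (?d / 2)"
        using Gx by (simp only: norm_of_real abs_of_pos)
      have 5: "norm (complex_of_real (1 / c)) = 1 / c" "norm (complex_of_real (2 / \<alpha>)) = 2 / \<alpha>"
        using c \<alpha> by (simp_all only: norm_of_real abs_of_pos divide_pos_pos zero_less_one zero_less_numeral)
      have "norm (char_fun F \<tau>) = 1 / c * (2 / \<alpha> * norm (Gamma (v \<tau> / \<alpha>) / Gamma (v \<tau> / 2)) *
          exp (\<alpha> * \<gamma> * ln 2) * norm (Gamma ((of_nat DIM('a) - v \<tau>) / 2)) / Gamma (?d / 2))"
        unfolding char_F norm_mult[of "of_real (1 / c)"] norm_divide[of _ "complex_of_real (Gamma (?d / 2))"] norm_mult[of _ "Gamma ((of_nat DIM('a) - v \<tau>) / 2)"]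
          norm_mult[of _ "exp (- (v \<tau> * of_real (ln 2)))"] norm_mult[of "of_real (2 / \<alpha>)"] 3 4 5 ..
      also have "\<dots> \<le> 1 / c * (2 / \<alpha> * (Gamma (x / (\<alpha> / 2)) / Gamma x) *
          exp (\<alpha> * \<gamma> * ln 2) * (Gamma (?d / 2 - x + 2) / min 1 (?d / 2 - x) * inverse (1 + (\<tau> / 2)\<^sup>2)) / Gamma (?d / 2))"
        using c \<alpha> Gx x 1 2
        by (intro mult_left_mono divide_right_mono mult_mono)
          (auto intro!: mult_nonneg_nonneg divide_nonneg_nonneg order_trans[OF norm_ge_zero 1] less_imp_le[OF Gamma_real_pos])
      also have "\<dots> = K * inverse (1 + (0 + (1 / 2) *\<^sub>R \<tau>)\<^sup>2)"
        by (simp add: K_def)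
      finally show "norm (char_fun F \<tau>) \<le> norm (K * inverse (1 + (0 + (1 / 2) *\<^sub>R \<tau>)\<^sup>2))"
        by (rule order_trans) simp
    qed
  qed measurable
  \<comment> \<open>Inversion identifies the densities almost everywhere only; continuity of both
    gives every y.\<close>
  have f_eq: "f y = Re (inv_fourier F y)" for y
  proof (rule continuous_AE_eq[OF cont])
    show "continuous_on UNIV (\<lambda>y. Re (inv_fourier F y))"
      by (intro continuous_intros F.continuous_inv_fourier int_F)
    have [measurable]: "inv_fourier F \<in> borel_measurable borel"
      by (rule F.borel_measurable_inv_fourier[OF int_F])
    have "density lborel (\<lambda>y. ennreal (f y)) = density lborel (\<lambda>y. ennreal (Re (inv_fourier F y)))"
      using F.fourier_inversion[OF int_F] unfolding F_def .
    then have "AE y in lborel. ennreal (f y) = ennreal (Re (inv_fourier F y))"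
      by (intro sigma_finite_measure.density_unique[OF lborel.sigma_finite_measure_axioms]) auto
    then show "AE y in lborel. f y = Re (inv_fourier F y)"
      by eventually_elim (simp add: f0 F.inv_fourier_nonneg[OF int_F])
  qed
  \<comment> \<open>The constants of \<open>char_F\<close> collected; by the sphere area formula, A
    \<alpha> is pi^(-d/2).\<close>
  define A where "A = 2 / (c * \<alpha> * Gamma (?d / 2))"
  have cG: "c * Gamma (?d / 2) = 2 * pi powr (?d / 2)"
    unfolding c_def by (rule unit_ball_vol_eq) simp
  have A: "A * \<alpha> = 1 / pi powr (?d / 2)"
  proof -
    have "A * \<alpha> = 2 / (c * Gamma (?d / 2))" using \<alpha> by (simp add: A_def)
    then show ?thesis unfolding cG by simp
  qed
  \<comment> \<open>At \<tau> = - \<alpha> t the inversion integrand is the Fox integrand times a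
    constant depending on \<gamma> and y, not on t.\<close>
  have G_eq: "iexp (- ((- \<alpha> * t) * y)) * char_fun F (- \<alpha> * t) = of_real (A * exp (- (\<alpha> * \<gamma> * y))) * h t" for t
  proof -
    define s where "s = Complex \<gamma> t"
    have vs: "v (- \<alpha> * t) = - (of_real \<alpha> * s)"
      by (simp add: v_def s_def complex_eq_iff)
    have z: "complex_of_real ((exp (- y) / 2) powr \<alpha>) powr (- s) = exp (of_real (\<alpha> * (y + ln 2)) * s)"
    proof -
      have "ln ((exp (- y) / 2) powr \<alpha>) = - (\<alpha> * (y + ln 2))"
        by (simp add: ln_powr ln_div algebra_simps)
      moreover have "(exp (- y) / 2) powr \<alpha> > 0" by simp
      ultimately have "Ln (complex_of_real ((exp (- y) / 2) powr \<alpha>)) = of_real (- (\<alpha> * (y + ln 2)))"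
        by (simp only: Ln_of_real)
      then show ?thesis by (simp add: powr_def mult.commute[of s])
    qed
    have h: "h t = Gamma (of_real (?d / 2) + of_real (\<alpha> / 2) * s) * Gamma (- s) / Gamma (- (of_real (\<alpha> / 2) * s)) *
        exp (of_real (\<alpha> * (y + ln 2)) * s)"
      unfolding h_def foxH_integrand_def s_def[symmetric] z
      by (simp add: numeral_2_eq_2)
    have arg: "v (- \<alpha> * t) / \<alpha> = - s" "v (- \<alpha> * t) / 2 = - (of_real (\<alpha> / 2) * s)"
      "(of_nat DIM('a) - v (- \<alpha> * t)) / 2 = of_real (?d / 2) + of_real (\<alpha> / 2) * s"
      unfolding vs using \<alpha> by (auto simp: field_simps)
    have e: "iexp (- ((- \<alpha> * t) * y)) * exp (- (v (- \<alpha> * t) * of_real (ln 2))) =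
        of_real (exp (- (\<alpha> * \<gamma> * y))) * exp (of_real (\<alpha> * (y + ln 2)) * s)"
      unfolding vs exp_of_real[symmetric] exp_add[symmetric]
      by (rule arg_cong[where f = exp]) (simp add: s_def complex_eq_iff algebra_simps)
    have "iexp (- ((- \<alpha> * t) * y)) * char_fun F (- \<alpha> * t) =
      of_real (1 / c) * (2 / \<alpha> * (Gamma (- s) / Gamma (- (of_real (\<alpha> / 2) * s))) *
       (iexp (- ((- \<alpha> * t) * y)) * exp (- (v (- \<alpha> * t) * of_real (ln 2)))) *
       Gamma (of_real (?d / 2) + of_real (\<alpha> / 2) * s) / of_real (Gamma (?d / 2)))"
      unfolding char_F arg by simp
    also have "\<dots> = of_real (A * exp (- (\<alpha> * \<gamma> * y))) * h t"
      unfolding e h A_def by (simp add: mult_ac)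
    finally show ?thesis .
  qed
  define B where "B = A * exp (- (\<alpha> * \<gamma> * y))"
  have "Gamma (?d / 2) > 0" by simp
  then have B: "B > 0" unfolding B_def A_def using c \<alpha> by simp
  define G where "G \<tau> = iexp (- (\<tau> * y)) * char_fun F \<tau>" for \<tau>
  have [measurable]: "G \<in> borel_measurable borel" unfolding G_def by measurable
  have int_G: "integrable lborel G"
    by (rule Bochner_Integration.integrable_bound[OF int_F]) (auto simp: G_def norm_mult)
  have Gh: "G (0 + (- \<alpha>) *\<^sub>R t) = of_real B * h t" for t
    using G_eq[of t] by (simp add: G_def B_def)
  have "integrable lborel (\<lambda>t. of_real B * h t)"
    unfolding Gh[symmetric] using \<alpha> int_G by (subst lborel_integral_affine(2)) auto
  from integrable_mult_right[OF this, of "of_real (1 / B)"] B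
  show "integrable lborel h" by simp
  have "complex_of_real (f y) = inv_fourier F y"
    using F.inv_fourier_real[OF int_F, of y] f_eq[of y] by (simp add: complex_eq_iff)
  also have "\<dots> = of_real (1 / (2 * pi)) * integral\<^sup>L lborel G"
    unfolding inv_fourier_def G_def by (simp add: powr_minus field_simps)
  also have "integral\<^sup>L lborel G = of_real \<alpha> * (of_real B * integral\<^sup>L lborel h)"
    using lborel_integral_affine(1)[of "- \<alpha>" G 0] \<alpha> unfolding Gh by (simp add: scaleR_conv_of_real)
  finally have "complex_of_real (f y) = of_real (\<alpha> * B / (2 * pi)) * integral\<^sup>L lborel h"
    by simp
  then have "integral\<^sup>L lborel h = of_real (f y * (2 * pi) / (\<alpha> * B))"
    using \<alpha> B by (simp add: field_simps)
  \<comment> \<open>The tilt exp (- \<alpha> \<gamma> y) cancels between f and B, so the value does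
    not depend on \<gamma>.\<close>
  also have "f y * (2 * pi) / (\<alpha> * B) = 2 * pi * (pi powr (?d / 2) * exp (- (?d * y)) * \<rho> (exp (- y)))"
  proof -
    have "\<alpha> * B = exp (- (\<alpha> * \<gamma> * y)) / pi powr (?d / 2)"
    proof -
      have "\<alpha> * B = A * \<alpha> * exp (- (\<alpha> * \<gamma> * y))" by (simp add: B_def)
      then show ?thesis unfolding A by simp
    qed
    moreover have "exp (- (\<mu> * y)) = exp (- (?d * y)) * exp (- (\<alpha> * \<gamma> * y))"
      by (simp add: \<mu>_def exp_add[symmetric] algebra_simps)
    ultimately show ?thesis by (simp add: f_def)
  qed
  finally show "integral\<^sup>L lborel h = of_real (2 * pi * (pi powr (?d / 2) * exp (- (?d * y)) * \<rho> (exp (- y))))" .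
qed

text \<open>The description in \<open>foxH\<close> is resolved: any candidate value comes from a
  line in the strip, and all these lines give the same integral.\<close>

lemma foxH_eq:
  fixes y :: real
  shows "foxH 1 1 [(1, 1)] [(of_real (real DIM('a) / 2), \<alpha> / 2), (1, \<alpha> / 2)] (of_real ((exp (- y) / 2) powr \<alpha>)) =
    of_real (pi powr (real DIM('a) / 2) * exp (- (real DIM('a) * y)) * \<rho> (exp (- y)))"
    (is "foxH 1 1 ?A ?B ?z = of_real ?w")
proof -
  let ?d = "real DIM('a)"
  \<comment> \<open>The poles nearest to the strip are s = - d/\<alpha> on the left and s = 0 on the
    right.\<close>
  have sep: "foxH_separates 1 1 ?A ?B \<gamma> \<longleftrightarrow> - ?d / \<alpha> < \<gamma> \<and> \<gamma> < 0" for \<gamma>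
  proof
    assume sep: "foxH_separates 1 1 ?A ?B \<gamma>"
    have "complex_of_real (?d / 2) + of_real (\<alpha> / 2) * of_real (- ?d / \<alpha>) = 0"
      using \<alpha> by (simp add: field_simps)
    moreover have "\<forall>s. complex_of_real (?d / 2) + of_real (\<alpha> / 2) * s \<in> \<int>\<^sub>\<le>\<^sub>0 \<longrightarrow> Re s < \<gamma>"
      using sep unfolding foxH_separates_def by simp
    ultimately have "Re (of_real (- ?d / \<alpha>)) < \<gamma>"
      by (metis zero_in_nonpos_Ints)
    moreover have "\<forall>s::complex. - s \<in> \<int>\<^sub>\<le>\<^sub>0 \<longrightarrow> \<gamma> < Re s"
      using sep unfolding foxH_separates_def by simp
    from this[rule_format, of 0] have "\<gamma> < 0" by simp
    ultimately show "- ?d / \<alpha> < \<gamma> \<and> \<gamma> < 0" by simp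
  next
    assume \<gamma>: "- ?d / \<alpha> < \<gamma> \<and> \<gamma> < 0"
    have "Re s < \<gamma>" if "of_real (?d / 2) + of_real (\<alpha> / 2) * s \<in> \<int>\<^sub>\<le>\<^sub>0" for s
    proof -
      from that obtain n where n: "of_real (?d / 2) + of_real (\<alpha> / 2) * s = of_int n" "n \<le> 0"
        by (auto elim!: nonpos_Ints_cases)
      have "Re (of_real (?d / 2) + of_real (\<alpha> / 2) * s) \<le> 0"
        unfolding n(1) using n(2) by simp
      then have "Re s \<le> - ?d / \<alpha>" using \<alpha> by (simp add: field_simps)
      with \<gamma> show ?thesis by linarith
    qed
    moreover have "\<gamma> < Re s" if "1 - 1 - of_real 1 * s \<in> \<int>\<^sub>\<le>\<^sub>0" for s :: complex
    proof -
      from that obtain n where n: "- s = of_int n" "n \<le> 0"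
        by (auto elim!: nonpos_Ints_cases)
      have "Re (- s) \<le> 0" unfolding n(1) using n(2) by simp
      with \<gamma> show ?thesis by simp
    qed
    ultimately show "foxH_separates 1 1 ?A ?B \<gamma>"
      unfolding foxH_separates_def by auto
  qed
  have line: "((\<lambda>t::real. foxH_integrand 1 1 ?A ?B ?z (Complex \<gamma> t) * \<i>) has_integral (2 * of_real pi * \<i> * of_real ?w)) UNIV"
    if "- ?d / \<alpha> < \<gamma> \<and> \<gamma> < 0" for \<gamma>
  proof -
    note L = foxH_line_integral[of \<gamma> y]
    have "((\<lambda>t. foxH_integrand 1 1 ?A ?B ?z (Complex \<gamma> t)) has_integral of_real (2 * pi * ?w)) UNIV"
      using has_integral_integral_lborel[OF L(1)] L(2) that by simp
    from has_integral_mult_left[OF this, of \<i>] show ?thesis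
      by (simp add: mult_ac)
  qed
  \<comment> \<open>The midpoint of the strip serves as a separating line.\<close>
  have ex: "- ?d / \<alpha> < - ?d / (2 * \<alpha>) \<and> - ?d / (2 * \<alpha>) < 0"
    using \<alpha> by (simp add: field_simps)
  show ?thesis
    unfolding foxH_def
  proof (rule the_equality)
    show "\<exists>\<gamma>. foxH_separates 1 1 ?A ?B \<gamma> \<and>
      ((\<lambda>t::real. foxH_integrand 1 1 ?A ?B ?z (Complex \<gamma> t) * \<i>) has_integral (2 * of_real pi * \<i> * of_real ?w)) UNIV"
      using ex line[OF ex] unfolding sep by blast
    fix w assume "\<exists>\<gamma>. foxH_separates 1 1 ?A ?B \<gamma> \<and>
      ((\<lambda>t::real. foxH_integrand 1 1 ?A ?B ?z (Complex \<gamma> t) * \<i>) has_integral (2 * of_real pi * \<i> * w)) UNIV"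
    then obtain \<gamma> where "- ?d / \<alpha> < \<gamma> \<and> \<gamma> < 0"
      "((\<lambda>t::real. foxH_integrand 1 1 ?A ?B ?z (Complex \<gamma> t) * \<i>) has_integral (2 * of_real pi * \<i> * w)) UNIV"
      unfolding sep by blast
    from has_integral_unique[OF this(2) line[OF this(1)]] show "w = of_real ?w" by simp
  qed
qed

end

end

section \<open>Identification of the density\<close>

lemma stable_density_eq:
  fixes N :: "(real ^ 'd) measure"
  assumes "symmetric_stable N \<alpha>" and sym: "spherically_symmetric N" and x: "x \<noteq> 0"
  shows "stable_density \<alpha> x = of_real (Re (inv_fourier N x))"
proof -
  interpret symmetric_stable N \<alpha> by fact
  obtain e :: "real ^ 'd" where e: "norm e = 1" using vector_choose_size[of 1] by auto
  \<comment> \<open>The density along one fixed ray. Orthogonal maps act transitively on spheres, so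
    it determines the density everywhere.\<close>
  define \<rho> where "\<rho> r = Re (inv_fourier N (r *\<^sub>R e))" for r
  have radial: "Re (inv_fourier N x) = \<rho> (norm x)" for x
  proof -
    have "norm (norm x *\<^sub>R e) = norm x" using e by simp
    from orthogonal_transformation_exists[OF this] obtain U
      where "orthogonal_transformation U" "U (norm x *\<^sub>R e) = x" .
    then show ?thesis
      using inv_fourier_orthogonal[OF sym, of U "norm x *\<^sub>R e"] by (simp add: \<rho>_def)
  qed
  let ?d = "real CARD('d)"
  have nx: "exp (- (- ln (norm x))) = norm x" using x by simp
  have "foxH 1 1 [(1, 1)] [(of_real (?d / 2), \<alpha> / 2), (1, \<alpha> / 2)] (of_real ((norm x / 2) powr \<alpha>)) =
      of_real (pi powr (?d / 2) * exp (- (?d * - ln (norm x))) * \<rho> (norm x))"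
    using foxH_eq[OF radial, of "- ln (norm x)"] unfolding nx by simp
  also have "exp (- (?d * - ln (norm x))) = norm x powr ?d"
    using x by (simp add: powr_def)
  finally have H: "foxH 1 1 [(1, 1)] [(of_real (?d / 2), \<alpha> / 2), (1, \<alpha> / 2)] (of_real ((norm x / 2) powr \<alpha>)) =
      of_real (pi powr (?d / 2) * norm x powr ?d * \<rho> (norm x))" .
  have "(pi powr (- ?d / 2) * norm x powr (- ?d)) * (pi powr (?d / 2) * norm x powr ?d * \<rho> (norm x)) = \<rho> (norm x)"
    using x by (simp add: powr_minus field_simps)
  then show ?thesis
    unfolding stable_density_def H of_real_mult[symmetric] radial by (rule arg_cong)
qed

theorem theorem3p3:
  fixes M :: "'w measure" and X :: "'w \<Rightarrow> real ^ 'd" and \<alpha> :: real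
  assumes "prob_space M"
    and "X \<in> borel_measurable M"
    and "0 < \<alpha>" and "\<alpha> \<le> 2"
    and "spherically_symmetric (distr M borel X)"
    and "stable_law \<alpha> (distr M borel X)"
    and "unit_scale (distr M borel X)"
  shows "(\<forall>\<xi>. char_fun (distr M borel X) \<xi> = of_real (exp (- (norm \<xi> powr \<alpha>)))) \<and>
    (\<forall>x :: real ^ 'd. x \<noteq> 0 \<longrightarrow> stable_density \<alpha> x \<in> \<real> \<and> 0 \<le> Re (stable_density \<alpha> x)) \<and>
    distributed M lborel X (\<lambda>x. ennreal (Re (stable_density \<alpha> x)))"
proof -
  define N where "N = distr M borel X"
  interpret M: prob_space M by fact
  interpret N: prob_space N
    unfolding N_def using assms(2) by (rule M.prob_space_distr)
  have char: "char_fun N \<xi> = of_real (exp (- (norm \<xi> powr \<alpha>)))" for \<xi>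
    by (rule char_fun_symmetric_stable) (use assms in \<open>auto simp: N_def M.prob_space_distr\<close>)
  have S: "symmetric_stable N \<alpha>"
    by unfold_locales (use assms char in \<open>auto simp: N_def\<close>)
  then interpret S: symmetric_stable N \<alpha> .
  have dens: "stable_density \<alpha> x = of_real (Re (inv_fourier N x))" if "x \<noteq> 0" for x
    by (rule stable_density_eq[OF S _ that]) (use assms in \<open>simp add: N_def\<close>)
  \<comment> \<open>The power of \<open>norm 0\<close> is 0 by convention. Knowing the value at the
    origin makes the density measurable on the whole space, and the origin itself is a null
    set.\<close>
  have at_0: "stable_density \<alpha> (0 :: real ^ 'd) = 0"
    by (simp add: stable_density_def)
  have eq: "ennreal (Re (stable_density \<alpha> x)) = (if x = 0 then 0 else ennreal (Re (inv_fourier N x)))" for x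
    by (simp add: dens at_0)
  have meas: "(\<lambda>x::real ^ 'd. ennreal (Re (stable_density \<alpha> x))) \<in> borel_measurable borel"
    unfolding eq by measurable
  have "N = density lborel (\<lambda>x. ennreal (Re (inv_fourier N x)))"
    by (rule S.density_N)
  also have "\<dots> = density lborel (\<lambda>x. ennreal (Re (stable_density \<alpha> x)))"
  proof (rule density_cong)
    show "AE x in lborel. ennreal (Re (inv_fourier N x)) = ennreal (Re (stable_density \<alpha> x))"
      using AE_lborel_singleton[of 0] by eventually_elim (simp add: dens)
  qed (use meas in simp_all)
  finally have "distributed M lborel X (\<lambda>x. ennreal (Re (stable_density \<alpha> x)))"
    unfolding distributed_def using assms(2) meas by (auto simp: N_def cong: distr_cong)
  then show ?thesis
    using char dens S.inv_fourier_nonneg[OF S.integrable_char] by (auto simp: N_def)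
qed

end
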